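(* $\mathrm{LUA}_{\mathrm{slow}}$ is not of deep degree; that is, there is no deep nonempty $\Pi^0_1$ set $P\subseteq\{0,1\}^{\mathbb{N}}$ with $P \equiv_{\mathrm{w}} \mathrm{LUA}_{\mathrm{slow}}$.
   Context: An order function is a computable (i.e. its values are uniformly computable reals), nondecreasing, unbounded function $\mathbb{N}\to\mathbb{R}$. An order function $q\colon\mathbb{N}\to(1,\infty)$ is slow-growing if $\sum_{n=0}^\infty q(n)^{-1}=\infty$. A partial recursive $\psi\colon\subseteq\mathbb{N}\to\mathbb{N}$ is linearly universal if for every partial recursive $\theta\colon\subseteq\mathbb{N}\to\mathbb{N}$ there are $a,b\in\mathbb{N}$ with $\psi(ax+b)\simeq\theta(x)$ for all $x$. For $p\colon\mathbb{N}\to(1,\infty)$, $\mathrm{LUA}(p)$ is the set of $X\in\mathbb{N}^{\mathbb{N}}$ such that $X(n)<p(n)$ for all $n$ and, for some linearly universal partial recursive $\psi$, there is no $n\in\operatorname{dom}\psi$ with $X(n)=\psi(n)$. $\mathrm{LUA}_{\mathrm{slow}}=\bigcup\{\mathrm{LUA}(q) : q\colon\mathbb{N}\to(1,\infty)\text{ a slow-growing order function}\}$. For $P,Q\subseteq\mathbb{N}^{\mathbb{N}}$, $P\leq_{\mathrm{w}}Q$ means every $Y\in Q$ Turing-computes some $X\in P$; $P\equiv_{\mathrm{w}}Q$ means $P\leq_{\mathrm{w}}Q$ and $Q\leq_{\mathrm{w}}P$. Depth: a continuous semimeasure on $\{0,1\}^*$ is $\nu\colon\{0,1\}^*\to[0,1]$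 with $\nu(\langle\rangle)=1$ and $\nu(\sigma)\geq\nu(\sigma^\frown 0)+\nu(\sigma^\frown 1)$. Fix a universal left r.e. continuous semimeasure $\mathbf{M}$, i.e. $\mathbf{M}$ is left r.e. (uniformly approximable from below) and for each left r.e. continuous semimeasure $\nu$ there is $c\in\mathbb{N}$ with $\nu(\sigma)\leq c\,\mathbf{M}(\sigma)$ for all $\sigma$. A $\Pi^0_1$ set $P\subseteq\{0,1\}^{\mathbb{N}}$ is deep if there is an order function $r\colon\mathbb{N}\to\mathbb{N}$ with $\sum_{\sigma\in P\upharpoonright r(n)}\mathbf{M}(\sigma)\leq 2^{-n}$ for all $n$, where $P\upharpoonright m=\{X\upharpoonright m : X\in P\}$. *)

theory Defs
  imports
    Complex_Main
    "HOL-Library.Nat_Bijection"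
    "HOL-Library.Countable"
    "HOL-Library.Extended_Nonnegative_Real"
begin

section \<open>Partial recursive functions, with and without oracle\<close>

datatype rec_prog =
    Zero
  | Succ
  | Proj nat
  | Oracle
  | Comp rec_prog "rec_prog list"
  | PrimRec rec_prog rec_prog
  | Mu rec_prog

text \<open>
  Kleene's schemes. Arities are not tracked: a program is run on an argument list of any
  length, and the result is \<^const>\<open>None\<close> if the computation diverges or if an argument is missing.
  The list function \<^const>\<open>those\<close> turns a list of defined values into the list of these values, and is
  \<^const>\<open>None\<close> as soon as one entry is undefined.
\<close>

fun rec_eval :: "(nat \<rightharpoonup> nat) \<Rightarrow> rec_prog \<Rightarrow> nat list \<rightharpoonup> nat" where
  "rec_eval A Zero xs = Some 0"
| "rec_eval A Succ xs = (case xs of [] \<Rightarrow> None | x # _ \<Rightarrow> Some (Suc x))"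
| "rec_eval A (Proj i) xs = (if i < length xs then Some (xs ! i) else None)"
| "rec_eval A Oracle xs = (case xs of [] \<Rightarrow> None | x # _ \<Rightarrow> A x)"
| "rec_eval A (Comp f gs) xs = Option.bind (those (map (\<lambda>g. rec_eval A g xs) gs)) (rec_eval A f)"
| "rec_eval A (PrimRec f g) xs =
     (case xs of [] \<Rightarrow> None
      | n # ys \<Rightarrow>
          rec_nat (rec_eval A f ys) (\<lambda>m r. Option.bind r (\<lambda>v. rec_eval A g (m # v # ys))) n)"
| "rec_eval A (Mu f) xs =
     (if \<exists>n. rec_eval A f (n # xs) = Some 0 \<and> (\<forall>i<n. rec_eval A f (i # xs) \<noteq> None)
      then Some (LEAST n. rec_eval A f (n # xs) = Some 0)
      else None)"

text \<open>
  Unrelativized computations are run with the nowhere defined oracle, so that an oracle call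
  diverges.
\<close>

definition partial_recursive :: "(nat \<rightharpoonup> nat) \<Rightarrow> bool" where
  "partial_recursive \<psi> \<longleftrightarrow> (\<exists>e. \<forall>x. rec_eval Map.empty e [x] = \<psi> x)"

definition recursive2 :: "(nat \<Rightarrow> nat \<Rightarrow> nat) \<Rightarrow> bool" where
  "recursive2 f \<longleftrightarrow> (\<exists>e. \<forall>x y. rec_eval Map.empty e [x, y] = Some (f x y))"

definition rec_enumerable :: "nat set \<Rightarrow> bool" where
  "rec_enumerable W \<longleftrightarrow> (\<exists>\<psi>. partial_recursive \<psi> \<and> W = dom \<psi>)"

definition turing_computes :: "(nat \<Rightarrow> nat) \<Rightarrow> (nat \<Rightarrow> nat) \<Rightarrow> bool" where
  "turing_computes Y X \<longleftrightarrow> (\<exists>e. \<forall>n. rec_eval (\<lambda>k. Some (Y k)) e [n] = Some (X n))"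

section \<open>Weak reducibility\<close>

definition weakly_reducible :: "(nat \<Rightarrow> nat) set \<Rightarrow> (nat \<Rightarrow> nat) set \<Rightarrow> bool"
    (infix "\<le>\<^sub>w" 50) where
  "P \<le>\<^sub>w Q \<longleftrightarrow> (\<forall>Y\<in>Q. \<exists>X\<in>P. turing_computes Y X)"

definition weakly_equivalent :: "(nat \<Rightarrow> nat) set \<Rightarrow> (nat \<Rightarrow> nat) set \<Rightarrow> bool"
    (infix "\<equiv>\<^sub>w" 50) where
  "P \<equiv>\<^sub>w Q \<longleftrightarrow> P \<le>\<^sub>w Q \<and> Q \<le>\<^sub>w P"

section \<open>Order functions\<close>

text \<open>
  The surjection \<^const>\<open>nat_to_rat_surj\<close> from \<^typ>\<open>nat\<close> to \<^typ>\<open>rat\<close> is effective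
  (it decodes numerator and denominator), so it serves as the coding of rationals.
\<close>

definition computable_real_seq :: "(nat \<Rightarrow> real) \<Rightarrow> bool" where
  "computable_real_seq q \<longleftrightarrow>
     (\<exists>f. recursive2 f \<and> (\<forall>n k. \<bar>q n - of_rat (nat_to_rat_surj (f n k))\<bar> \<le> 1 / 2 ^ k))"

definition order_function :: "(nat \<Rightarrow> real) \<Rightarrow> bool" where
  "order_function q \<longleftrightarrow> computable_real_seq q \<and> mono q \<and> (\<forall>B. \<exists>n. B < q n)"

definition slow_growing :: "(nat \<Rightarrow> real) \<Rightarrow> bool" where
  "slow_growing q \<longleftrightarrow>
     order_function q \<and> (\<forall>n. 1 < q n) \<and> (\<Sum>n. ennreal (inverse (q n))) = \<infinity>"

section \<open>Linearly universal avoidance\<close>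

definition linearly_universal :: "(nat \<rightharpoonup> nat) \<Rightarrow> bool" where
  "linearly_universal \<psi> \<longleftrightarrow>
     partial_recursive \<psi> \<and>
     (\<forall>\<theta>. partial_recursive \<theta> \<longrightarrow> (\<exists>a b. \<forall>x. \<psi> (a * x + b) = \<theta> x))"

definition LUA :: "(nat \<Rightarrow> real) \<Rightarrow> (nat \<Rightarrow> nat) set" where
  "LUA p = {X. (\<forall>n. real (X n) < p n) \<and>
               (\<exists>\<psi>. linearly_universal \<psi> \<and> \<not> (\<exists>n\<in>dom \<psi>. \<psi> n = Some (X n)))}"

definition LUA_slow :: "(nat \<Rightarrow> nat) set" where
  "LUA_slow = \<Union> {LUA q | q. slow_growing q}"

section \<open>Cantor space and depth\<close>

text \<open>
  Cantor space is \<^typ>\<open>nat \<Rightarrow> bool\<close>, finite strings are of type \<^typ>\<open>bool list\<close>,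
  with \<^const>\<open>False\<close> for 0 and \<^const>\<open>True\<close> for 1.
\<close>

definition baire_of :: "(nat \<Rightarrow> bool) \<Rightarrow> nat \<Rightarrow> nat" where
  "baire_of X n = of_bool (X n)"

definition string_code :: "bool list \<Rightarrow> nat" where
  "string_code \<sigma> = list_encode (map of_bool \<sigma>)"

definition init_seg :: "(nat \<Rightarrow> bool) \<Rightarrow> nat \<Rightarrow> bool list" where
  "init_seg X m = map X [0..<m]"

text \<open>The complement is a union of basic open sets given by an r.e. set of strings.\<close>

definition Pi01_class :: "(nat \<Rightarrow> bool) set \<Rightarrow> bool" where
  "Pi01_class P \<longleftrightarrow>
     (\<exists>W. rec_enumerable W \<and> P = {X. \<forall>n. string_code (init_seg X n) \<notin> W})"

definition continuous_semimeasure :: "(bool list \<Rightarrow> real) \<Rightarrow> bool" where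
  "continuous_semimeasure \<nu> \<longleftrightarrow>
     (\<forall>\<sigma>. 0 \<le> \<nu> \<sigma> \<and> \<nu> \<sigma> \<le> 1) \<and> \<nu> [] = 1 \<and>
     (\<forall>\<sigma>. \<nu> (\<sigma> @ [False]) + \<nu> (\<sigma> @ [True]) \<le> \<nu> \<sigma>)"

definition left_re :: "(bool list \<Rightarrow> real) \<Rightarrow> bool" where
  "left_re \<nu> \<longleftrightarrow>
     (\<exists>f. recursive2 f \<and>
       (\<forall>\<sigma>. incseq (\<lambda>s. nat_to_rat_surj (f (string_code \<sigma>) s)) \<and>
            (\<lambda>s. of_rat (nat_to_rat_surj (f (string_code \<sigma>) s))) \<longlonglongrightarrow> \<nu> \<sigma>))"

definition universal_semimeasure :: "(bool list \<Rightarrow> real) \<Rightarrow> bool" where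
  "universal_semimeasure M \<longleftrightarrow>
     continuous_semimeasure M \<and> left_re M \<and>
     (\<forall>\<nu>. continuous_semimeasure \<nu> \<and> left_re \<nu> \<longrightarrow>
        (\<exists>c::nat. \<forall>\<sigma>. \<nu> \<sigma> \<le> real c * M \<sigma>))"

definition deep :: "(bool list \<Rightarrow> real) \<Rightarrow> (nat \<Rightarrow> bool) set \<Rightarrow> bool" where
  "deep M P \<longleftrightarrow>
     Pi01_class P \<and>
     (\<exists>r :: nat \<Rightarrow> nat. order_function (\<lambda>n. real (r n)) \<and>
       (\<forall>n. (\<Sum>\<sigma>\<in>(\<lambda>X. init_seg X (r n)) ` P. M \<sigma>) \<le> 1 / 2 ^ n))"

end

theory Submission
  imports Defs "HOL-Analysis.Summation_Tests"
begin

text \<open>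
  If \<open>LUA_slow\<close> is weakly below a nonempty class, it is nonempty itself and yields a linearly universal
  \<open>\<psi>\<close>, so it suffices to show that a deep class \<open>P\<close> is never weakly below \<open>LUA_slow\<close>. Let \<open>r\<close> be a modulus of depth of
  \<open>P\<close>. Take a slow-growing \<open>q\<close> that is at least \<open>(m + 2) 2^r(m)\<close> from position \<open>l(m)\<close> on, with \<open>l(m)\<close> so
  small that, up to a constant factor, a set that is \<open>k\<close>-small above a string remains \<open>k\<close>-small above
  a random \<open>q\<close>-bounded extension of length \<open>l(m)\<close> with probability at least \<open>(3/4)^m\<close>.

  A sequence that is \<open>q\<close>-bounded, avoids \<open>\<psi>\<close> and computes no member of \<open>P\<close> is built by bushy tree
  forcing. Given a functional, if it cannot be forced to be partial or to leave \<open>P\<close>, then above each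
  such random string of length \<open>l(m)\<close> the first \<open>r(m)\<close> output bits converge on a \<open>k 2^r(m)\<close>-big set, and
  by the pigeonhole principle some single output is taken on a \<open>k\<close>-big set and must be in \<open>P\<close>.
  Searching for such outputs, with weight about \<open>(3/4)^m\<close> on \<open>m\<close>, gives a left r.e. semimeasure that
  assigns about \<open>(9/16)^m\<close> to the strings of length \<open>r(m)\<close> of \<open>P\<close>. Depth allows only \<open>O(2^-m)\<close>.
\<close>


section \<open>A calculus of total computable functions\<close>

text \<open>The obstacle is that the pigeonhole over the outputs of length \<open>r m\<close> costs
  a factor \<open>2 ^ r m\<close> in the parameter, hence works only above strings as long as
  \<open>l(m)\<close>, and there is no evident computable way to pick such a string above which the
  forbidden set is still small. So the search runs above all extensions of that length without
  consulting the forbidden set, each extension voting for the first output found; smallness enters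
  only when the correct votes are counted. A place with bound \<open>q\<close> loses at most the
  fraction \<open>k / q\<close> of the extensions. A block of \<open>2 ^ r m\<close> places with
  bound \<open>(m + 2) * 2 ^ r m\<close> thus keeps at least \<open>1 - k / (m + 2)\<close> of them
  and adds \<open>1 / (m + 2)\<close> to the sum of reciprocals: the harmonic series gives slow
  growth, and \<open>3 / 4\<close> is kept per block once \<open>4 * k\<close> is at most
  \<open>m + 2\<close>. The ratio \<open>3 / 4\<close> serves both as density and as mixture weight;
  what counts is that it is below \<open>1\<close> and its square is above the \<open>1 / 2\<close>
  of depth.\<close>

class enc =
  fixes enc :: "'a \<Rightarrow> nat"
  assumes enc_eq_iff: "enc x = enc y \<longleftrightarrow> x = y"

instantiation nat :: enc
begin
definition enc_nat :: "nat \<Rightarrow> nat" where "enc_nat n = n"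
instance by standard (simp add: enc_nat_def)
end

instantiation bool :: enc
begin
definition enc_bool :: "bool \<Rightarrow> nat" where "enc_bool b = of_bool b"
instance by standard (auto simp: enc_bool_def)
end

instantiation prod :: (enc, enc) enc
begin
definition enc_prod :: "'a \<times> 'b \<Rightarrow> nat" where "enc_prod p = prod_encode (enc (fst p), enc (snd p))"
instance by standard (auto simp: enc_prod_def enc_eq_iff prod_eq_iff)
end

instantiation list :: (enc) enc
begin
definition enc_list :: "'a list \<Rightarrow> nat" where "enc_list xs = list_encode (map enc xs)"
instance proof
  fix xs ys :: "'a list"
  have "inj (enc :: 'a \<Rightarrow> nat)"
    by (auto simp: inj_def enc_eq_iff)
  then show "enc xs = enc ys \<longleftrightarrow> xs = ys"
    by (simp add: enc_list_def list_encode_eq)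
qed
end

instantiation option :: (enc) enc
begin
definition enc_option :: "'a option \<Rightarrow> nat"
  where "enc_option z = (case z of None \<Rightarrow> 0 | Some x \<Rightarrow> Suc (enc x))"
instance by standard (auto simp: enc_option_def enc_eq_iff split: option.splits)
end

lemma enc_Nil: "enc [] = 0"
  and enc_Cons: "enc (x # xs) = Suc (prod_encode (enc x, enc xs))"
  by (simp_all add: enc_list_def)

text \<open>Lets the code of a list bound the number of rounds when the list is consumed by
  primitive recursion.\<close>

lemma length_le_enc: "length xs \<le> enc xs"
  by (induction xs) (auto simp: enc_Nil enc_Cons intro: order_trans[OF _ le_prod_encode_2])

text \<open>A program has to be right on codes only; its behaviour on other numbers is left
  open.\<close>

definition computable :: "('a::enc \<Rightarrow> 'b::enc) \<Rightarrow> bool" where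
  "computable f \<longleftrightarrow> (\<exists>e. \<forall>x. rec_eval Map.empty e [enc x] = Some (enc (f x)))"

section \<open>Programs for arithmetic and Cantor pairing\<close>

definition add_prog :: rec_prog where
  "add_prog = PrimRec (Proj 0) (Comp Succ [Proj 1])"
definition triangle_prog :: rec_prog where
  "triangle_prog = PrimRec Zero (Comp add_prog [Comp Succ [Proj 0], Proj 1])"
definition pair_prog :: rec_prog where
  "pair_prog = Comp add_prog [Comp triangle_prog [Comp add_prog [Proj 0, Proj 1]], Proj 0]"
definition pred_prog :: rec_prog where
  "pred_prog = PrimRec Zero (Proj 0)"
definition sub_prog :: rec_prog where
  "sub_prog = Comp (PrimRec (Proj 0) (Comp pred_prog [Proj 1])) [Proj 1, Proj 0]"
primrec const_prog :: "nat \<Rightarrow> rec_prog" where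
  "const_prog 0 = Zero"
| "const_prog (Suc n) = Comp Succ [const_prog n]"

lemma rec_eval_add_prog: "rec_eval A add_prog (x # y # zs) = Some (x + y)"
  by (induction x) (auto simp: add_prog_def)

lemma rec_eval_triangle_prog: "rec_eval A triangle_prog (x # zs) = Some (triangle x)"
  by (induction x) (auto simp: triangle_prog_def rec_eval_add_prog)

lemma rec_eval_pair_prog: "rec_eval A pair_prog (x # y # zs) = Some (prod_encode (x, y))"
  by (simp add: pair_prog_def rec_eval_triangle_prog rec_eval_add_prog prod_encode_def)

lemma rec_eval_pred_prog: "rec_eval A pred_prog (x # zs) = Some (x - 1)"
  by (induction x) (auto simp: pred_prog_def)

lemma rec_eval_sub_prog: "rec_eval A sub_prog (x # y # zs) = Some (x - y)"
  by (induction y) (auto simp: sub_prog_def rec_eval_pred_prog)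

lemma rec_eval_const_prog: "rec_eval A (const_prog n) xs = Some n"
  by (induction n) auto

lemmas rec_eval_progs = rec_eval_pair_prog rec_eval_pred_prog rec_eval_sub_prog
  rec_eval_const_prog rec_eval_add_prog rec_eval_triangle_prog

text \<open>The inverse of the triangular numbers, rounded down. The truncated differences act as a
  comparison: \<open>1\<close> is added exactly when the next triangular number does not exceed
  \<open>Suc c\<close>. On a pair code the result is the sum of the components, from which both are
  recovered.\<close>

primrec tri_root :: "nat \<Rightarrow> nat" where
  "tri_root 0 = 0"
| "tri_root (Suc c) = tri_root c + (1 - (triangle (Suc (tri_root c)) - Suc c))"

definition tri_root_prog :: rec_prog where
  "tri_root_prog = PrimRec Zero (Comp add_prog [Proj 1, Comp sub_prog [const_prog 1,
     Comp sub_prog [Comp triangle_prog [Comp Succ [Proj 1]], Comp Succ [Proj 0]]]])"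

lemma rec_eval_tri_root_prog: "rec_eval A tri_root_prog (x # zs) = Some (tri_root x)"
  by (induction x) (auto simp: tri_root_prog_def rec_eval_progs simp del: const_prog.simps)

lemma tri_root_bounds: "triangle (tri_root c) \<le> c \<and> c < triangle (Suc (tri_root c))"
proof (induction c)
  case (Suc c)
  show ?case
  proof (cases "triangle (Suc (tri_root c)) \<le> Suc c")
    case True
    then show ?thesis using Suc by auto
  next
    case False
    then show ?thesis using Suc by auto
  qed
qed simp

lemma triangle_mono: "m \<le> n \<Longrightarrow> triangle m \<le> triangle n"
  by (induction rule: dec_induct) auto

lemma tri_root_prod_encode: "tri_root (prod_encode (m, n)) = m + n"
proof -
  let ?c = "prod_encode (m, n)"
  have "triangle (m + n) \<le> ?c" "?c < triangle (Suc (m + n))"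
    by (auto simp: prod_encode_def)
  then have "\<not> Suc (m + n) \<le> tri_root ?c" "\<not> Suc (tri_root ?c) \<le> m + n"
    using tri_root_bounds[of ?c] triangle_mono[of "Suc (m + n)" "tri_root ?c"]
      triangle_mono[of "Suc (tri_root ?c)" "m + n"] by linarith+
  then show ?thesis by linarith
qed

definition fst_prog :: rec_prog where
  "fst_prog = Comp sub_prog [Proj 0, Comp triangle_prog [tri_root_prog]]"
definition snd_prog :: rec_prog where
  "snd_prog = Comp sub_prog [tri_root_prog, fst_prog]"

lemma rec_eval_fst_prog: "rec_eval A fst_prog (prod_encode (m, n) # zs) = Some m"
  by (simp add: fst_prog_def rec_eval_progs rec_eval_tri_root_prog tri_root_prod_encode)
     (simp add: prod_encode_def)

lemma rec_eval_snd_prog: "rec_eval A snd_prog (prod_encode (m, n) # zs) = Some n"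
  by (simp add: snd_prog_def rec_eval_progs rec_eval_tri_root_prog tri_root_prod_encode
      rec_eval_fst_prog)

section \<open>Closure under composition, recursion and case distinction\<close>

named_theorems computable_intros

text \<open>Only codes matter, so a map that changes the type but not the code is computable for
  free. Decoding of pairs and lists is obtained in this way.\<close>

lemma computable_cong_enc:
  assumes "computable f" "\<And>x. enc (g x) = enc (f x)"
  shows "computable g"
  using assms by (simp add: computable_def)

lemma computable_id [computable_intros]: "computable (\<lambda>x. x)"
  unfolding computable_def by (rule exI[of _ "Proj 0"]) simp

lemma computable_const [computable_intros]: "computable (\<lambda>x. c)"
  unfolding computable_def by (rule exI[of _ "const_prog (enc c)"]) (simp add: rec_eval_const_prog)

lemma computable_compose:
  assumes "computable f" "computable g"
  shows "computable (\<lambda>x. f (g x))"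
proof -
  obtain ef eg where "\<And>x. rec_eval Map.empty ef [enc x] = Some (enc (f x))"
    "\<And>x. rec_eval Map.empty eg [enc x] = Some (enc (g x))"
    using assms unfolding computable_def by blast
  then show ?thesis
    unfolding computable_def by (intro exI[of _ "Comp ef [eg]"]) simp
qed

lemma computable_Pair [computable_intros]:
  assumes "computable f" "computable g"
  shows "computable (\<lambda>x. (f x, g x))"
proof -
  obtain ef eg where "\<And>x. rec_eval Map.empty ef [enc x] = Some (enc (f x))"
    "\<And>x. rec_eval Map.empty eg [enc x] = Some (enc (g x))"
    using assms unfolding computable_def by blast
  then show ?thesis
    unfolding computable_def
    by (intro exI[of _ "Comp pair_prog [ef, eg]"]) (simp add: rec_eval_pair_prog enc_prod_def)
qed

lemma computable_fst [computable_intros]: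
  assumes "computable f" shows "computable (\<lambda>x. fst (f x))"
proof -
  have "computable (fst :: 'b \<times> 'c \<Rightarrow> _)"
    unfolding computable_def
    by (rule exI[of _ fst_prog]) (simp add: enc_prod_def rec_eval_fst_prog)
  then show ?thesis using assms by (rule computable_compose)
qed

lemma computable_snd [computable_intros]:
  assumes "computable f" shows "computable (\<lambda>x. snd (f x))"
proof -
  have "computable (snd :: 'b \<times> 'c \<Rightarrow> _)"
    unfolding computable_def
    by (rule exI[of _ snd_prog]) (simp add: enc_prod_def rec_eval_snd_prog)
  then show ?thesis using assms by (rule computable_compose)
qed

lemma computable_Suc [computable_intros]:
  assumes "computable f" shows "computable (\<lambda>x. Suc (f x))"
proof -
  have "computable Suc"
    unfolding computable_def by (rule exI[of _ Succ]) (simp add: enc_nat_def)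
  then show ?thesis using assms by (rule computable_compose)
qed

lemma computable_apply2:
  assumes "computable (\<lambda>p. h (fst p) (snd p))" "computable f" "computable g"
  shows "computable (\<lambda>x. h (f x) (g x))"
  using computable_compose[OF assms(1) computable_Pair[OF assms(2,3)]] by simp

lemma computable_apply3:
  assumes "computable (\<lambda>p. h (fst p) (fst (snd p)) (snd (snd p)))"
    "computable f" "computable g" "computable k"
  shows "computable (\<lambda>x. h (f x) (g x) (k x))"
  using computable_compose[OF assms(1) computable_Pair[OF assms(2) computable_Pair[OF assms(3,4)]]]
  by simp

lemma computable_rec_nat [computable_intros]:
  assumes "computable a" "computable (\<lambda>p. g (fst p) (fst (snd p)) (snd (snd p)))" "computable n"
  shows "computable (\<lambda>x. rec_nat (a x) (g x) (n x))"
proof -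
  obtain ea eg en where e: "\<And>x. rec_eval Map.empty ea [enc x] = Some (enc (a x))"
    "\<And>x m v. rec_eval Map.empty eg [prod_encode (enc x, prod_encode (m, enc v))] = Some (enc (g x m v))"
    "\<And>x. rec_eval Map.empty en [enc x] = Some (n x)"
    using assms unfolding computable_def by (auto simp: enc_prod_def enc_nat_def)
  \<comment> \<open>\<open>PrimRec\<close> supplies index, last value and parameter in this order;
    \<open>eg\<close> expects the parameter first.\<close>
  let ?p = "PrimRec ea (Comp eg [Comp pair_prog [Proj 2, Comp pair_prog [Proj 0, Proj 1]]])"
  have "rec_eval Map.empty ?p [m, enc x] = Some (enc (rec_nat (a x) (g x) m))" for m x
    by (induction m) (auto simp: e rec_eval_pair_prog numeral_2_eq_2)
  then show ?thesis
    unfolding computable_def by (intro exI[of _ "Comp ?p [en, Proj 0]"]) (simp add: e)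
qed

text \<open>The branches are run lazily, because a program for \<open>f\<close> may diverge on a number that is
  not a code.\<close>

lemma computable_case_code:
  assumes "computable l" "computable a" "computable (\<lambda>p. f (fst p) (snd p))"
    "\<And>x. enc (l x) = 0 \<and> h x = a x \<or> (\<exists>y. enc (l x) = Suc (enc y) \<and> h x = f x y)"
  shows "computable h"
proof -
  obtain el ea ef where e: "\<And>x. rec_eval Map.empty el [enc x] = Some (enc (l x))"
    "\<And>x. rec_eval Map.empty ea [enc x] = Some (enc (a x))"
    "\<And>x y. rec_eval Map.empty ef [prod_encode (enc x, enc y)] = Some (enc (f x y))"
    using assms(1-3) unfolding computable_def by (auto simp: enc_prod_def)
  \<comment> \<open>The sign of the code, \<open>0\<close> or \<open>1\<close>. As recursion length
    it runs the program for \<open>f\<close> only if the code is positive.\<close>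
  let ?sg = "Comp sub_prog [const_prog 1, Comp sub_prog [const_prog 1, el]]"
  let ?p = "Comp (PrimRec (Comp ea [Proj 0]) (Comp ef [Comp pair_prog [Proj 2, Comp pred_prog [Proj 3]]]))
    [?sg, Proj 0, el]"
  have "rec_eval Map.empty ?p [enc x] = Some (enc (h x))" for x
    using assms(4)[of x]
    by (auto simp: e rec_eval_progs numeral_2_eq_2 numeral_3_eq_3 simp del: const_prog.simps)
  then show ?thesis
    unfolding computable_def by blast
qed

lemma computable_case_list [computable_intros]:
  assumes "computable l" "computable a"
    "computable (\<lambda>p. f (fst p) (fst (snd p)) (snd (snd p)))"
  shows "computable (\<lambda>x. case l x of [] \<Rightarrow> a x | y # ys \<Rightarrow> f x y ys)"
proof (rule computable_case_code[OF assms(1,2), of "\<lambda>x p. f x (fst p) (snd p)"])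
  show "enc (l x) = 0 \<and> (case l x of [] \<Rightarrow> a x | y # ys \<Rightarrow> f x y ys) = a x \<or>
      (\<exists>y. enc (l x) = Suc (enc y) \<and> (case l x of [] \<Rightarrow> a x | y # ys \<Rightarrow> f x y ys) = f x (fst y) (snd y))" for x
    by (cases "l x") (auto simp: enc_Nil enc_Cons enc_prod_def intro!: exI[of _ "(hd (l x), tl (l x))"])
qed (fact assms(3))

lemma computable_case_option [computable_intros]:
  assumes "computable l" "computable a" "computable (\<lambda>p. f (fst p) (snd p))"
  shows "computable (\<lambda>x. case l x of None \<Rightarrow> a x | Some y \<Rightarrow> f x y)"
proof (rule computable_case_code[OF assms])
  show "enc (l x) = 0 \<and> (case l x of None \<Rightarrow> a x | Some y \<Rightarrow> f x y) = a x \<or>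
      (\<exists>y. enc (l x) = Suc (enc y) \<and> (case l x of None \<Rightarrow> a x | Some y \<Rightarrow> f x y) = f x y)" for x
    by (cases "l x") (auto simp: enc_option_def)
qed

lemma computable_case_nat [computable_intros]:
  assumes "computable l" "computable a" "computable (\<lambda>p. f (fst p) (snd p))"
  shows "computable (\<lambda>x. case l x of 0 \<Rightarrow> a x | Suc y \<Rightarrow> f x y)"
proof (rule computable_case_code[OF assms])
  show "enc (l x) = 0 \<and> (case l x of 0 \<Rightarrow> a x | Suc y \<Rightarrow> f x y) = a x \<or>
      (\<exists>y. enc (l x) = Suc (enc y) \<and> (case l x of 0 \<Rightarrow> a x | Suc y \<Rightarrow> f x y) = f x y)" for x
    by (cases "l x") (auto simp: enc_nat_def)
qed

lemma computable_if [computable_intros]: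
  assumes "computable b" "computable f" "computable g"
  shows "computable (\<lambda>x. if b x then f x else g x)"
proof (rule computable_case_code[OF assms(1,3), of "\<lambda>x (y::nat). f x"])
  show "enc (b x) = 0 \<and> (if b x then f x else g x) = g x \<or>
      (\<exists>y::nat. enc (b x) = Suc (enc y) \<and> (if b x then f x else g x) = f x)" for x
    by (cases "b x") (auto simp: enc_bool_def enc_nat_def)
  show "computable (\<lambda>p :: 'a \<times> nat. f (fst p))"
    by (intro computable_compose[OF assms(2)] computable_intros)
qed

lemma computable_Some [computable_intros]:
  assumes "computable f" shows "computable (\<lambda>x. Some (f x))"
proof -
  have "computable (\<lambda>x. enc (f x))"
    by (rule computable_cong_enc[OF assms]) (simp add: enc_nat_def)
  then have "computable (\<lambda>x. Suc (enc (f x)))"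
    by (rule computable_Suc)
  then show ?thesis
    by (rule computable_cong_enc) (simp add: enc_option_def enc_nat_def)
qed

lemma computable_enc:
  assumes "computable f" shows "computable (\<lambda>x. enc (f x))"
  by (rule computable_cong_enc[OF assms]) (simp add: enc_nat_def)

lemma computable_Cons [computable_intros]:
  assumes "computable f" "computable g" shows "computable (\<lambda>x. f x # g x)"
  by (rule computable_cong_enc[OF computable_Suc[OF computable_enc[OF computable_Pair[OF assms]]]])
     (simp add: enc_Cons enc_nat_def enc_prod_def)

lemma computable_of_bool [computable_intros]:
  assumes "computable b" shows "computable (\<lambda>x. of_bool (b x) :: nat)"
  by (rule computable_cong_enc[OF assms]) (simp add: enc_nat_def enc_bool_def)

section \<open>Logic, arithmetic, bounded sums and bounded search\<close>

lemma computable_conj [computable_intros]: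
  assumes "computable b" "computable c" shows "computable (\<lambda>x. b x \<and> c x)"
proof -
  have "computable (\<lambda>x. if b x then c x else False)" by (intro computable_intros assms)
  then show ?thesis by (rule computable_cong_enc) simp
qed

lemma computable_not [computable_intros]:
  assumes "computable b" shows "computable (\<lambda>x. \<not> b x)"
proof -
  have "computable (\<lambda>x. if b x then False else True)" by (intro computable_intros assms)
  then show ?thesis by (rule computable_cong_enc) simp
qed

lemma computable_disj [computable_intros]:
  assumes "computable b" "computable c" shows "computable (\<lambda>x. b x \<or> c x)"
proof -
  have "computable (\<lambda>x. if b x then True else c x)" by (intro computable_intros assms)
  then show ?thesis by (rule computable_cong_enc) simp
qed

lemma computable_add [computable_intros]:
  assumes "computable f" "computable g" shows "computable (\<lambda>x. f x + g x :: nat)"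
proof -
  have "computable (\<lambda>x. rec_nat (f x) (\<lambda>_ r. Suc r) (g x))" by (intro computable_intros assms)
  moreover have "rec_nat a (\<lambda>_ r. Suc r) n = a + n" for a n by (induction n) auto
  ultimately show ?thesis by simp
qed

lemma computable_mult [computable_intros]:
  assumes "computable f" "computable g" shows "computable (\<lambda>x. f x * g x :: nat)"
proof -
  have "computable (\<lambda>x. rec_nat 0 (\<lambda>_ r. r + f x) (g x))"
    by (intro computable_intros assms computable_compose[OF assms(1)])
  moreover have "rec_nat 0 (\<lambda>_ r. r + a) n = a * n" for a n by (induction n) auto
  ultimately show ?thesis by simp
qed

lemma computable_power [computable_intros]:
  assumes "computable f" "computable g" shows "computable (\<lambda>x. f x ^ g x :: nat)"
proof -
  have "computable (\<lambda>x. rec_nat 1 (\<lambda>_ r. r * f x) (g x))"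
    by (intro computable_intros assms computable_compose[OF assms(1)])
  moreover have "rec_nat 1 (\<lambda>_ r. r * a) n = a ^ n" for a n :: nat by (induction n) auto
  ultimately show ?thesis by simp
qed

lemma computable_diff [computable_intros]:
  assumes "computable f" "computable g" shows "computable (\<lambda>x. f x - g x :: nat)"
proof -
  have "computable (\<lambda>x. rec_nat (f x) (\<lambda>_ r. case r of 0 \<Rightarrow> 0 | Suc y \<Rightarrow> y) (g x))"
    by (intro computable_intros assms)
  moreover have "rec_nat a (\<lambda>_ r. case r of 0 \<Rightarrow> 0 | Suc y \<Rightarrow> y) n = a - n" for a n
    by (induction n) (auto split: nat.splits)
  ultimately show ?thesis by simp
qed

lemma computable_le [computable_intros]:
  assumes "computable f" "computable g" shows "computable (\<lambda>x. f x \<le> (g x :: nat))"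
proof -
  have "computable (\<lambda>x. case f x - g x of 0 \<Rightarrow> True | Suc y \<Rightarrow> False)"
    by (intro computable_intros assms)
  moreover have "(case m - n of 0 \<Rightarrow> True | Suc y \<Rightarrow> False) \<longleftrightarrow> m \<le> n" for m n :: nat
    by (auto split: nat.splits)
  ultimately show ?thesis by simp
qed

lemma computable_less [computable_intros]:
  assumes "computable f" "computable g" shows "computable (\<lambda>x. f x < (g x :: nat))"
proof -
  have "computable (\<lambda>x. \<not> g x \<le> f x)" by (intro computable_intros assms)
  then show ?thesis by (rule computable_cong_enc) (simp add: not_le)
qed

lemma computable_eq [computable_intros]:
  assumes "computable f" "computable g" shows "computable (\<lambda>x. f x = g x)"
proof -
  have "computable (\<lambda>x. enc (f x) \<le> enc (g x) \<and> enc (g x) \<le> enc (f x))"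
    by (intro computable_intros computable_enc assms)
  moreover have "f x = g x \<longleftrightarrow> enc (f x) \<le> enc (g x) \<and> enc (g x) \<le> enc (f x)" for x
    by (metis antisym enc_eq_iff order_refl)
  ultimately show ?thesis by simp
qed

lemma computable_sum [computable_intros]:
  fixes f :: "'a::enc \<Rightarrow> nat \<Rightarrow> nat"
  assumes "computable (\<lambda>p. f (fst p) (snd p))" "computable n"
  shows "computable (\<lambda>x. \<Sum>i<n x. f x i)"
proof -
  have "computable (\<lambda>x. rec_nat 0 (\<lambda>i r. r + f x i) (n x))"
    by (intro computable_intros assms computable_apply2[OF assms(1)])
  moreover have "rec_nat 0 (\<lambda>i r. r + g i) m = (\<Sum>i<m. g i)" for g :: "nat \<Rightarrow> nat" and m
    by (induction m) auto
  ultimately show ?thesis by simp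
qed

lemma computable_Ball_less [computable_intros]:
  fixes P :: "'a::enc \<Rightarrow> nat \<Rightarrow> bool"
  assumes "computable (\<lambda>p. P (fst p) (snd p))" "computable n"
  shows "computable (\<lambda>x. \<forall>i<n x. P x i)"
proof -
  have "computable (\<lambda>x. rec_nat True (\<lambda>i r. r \<and> P x i) (n x))"
    by (intro computable_intros assms computable_apply2[OF assms(1)])
  moreover have "rec_nat True (\<lambda>i r. r \<and> Q i) m \<longleftrightarrow> (\<forall>i<m. Q i)" for Q m
    by (induction m) (auto simp: less_Suc_eq)
  ultimately show ?thesis by simp
qed

text \<open>The least witness equals the number of \<open>j\<close> such that no
  \<open>i \<le> j\<close> is a witness, and this number is a bounded sum. The assumed witness below
  \<open>n x\<close> makes the sum long enough.\<close>

lemma computable_bounded_least: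
  fixes P :: "'a::enc \<Rightarrow> nat \<Rightarrow> bool"
  assumes "computable (\<lambda>p. P (fst p) (snd p))" "computable n"
    "\<And>x. \<exists>i<n x. P x i"
  shows "computable (\<lambda>x. LEAST i. P x i)"
proof -
  have "computable (\<lambda>x. \<Sum>j<n x. of_bool (\<forall>i<Suc j. \<not> P x i) :: nat)"
    by (intro computable_intros assms computable_apply2[OF assms(1)])
  moreover have "(\<Sum>j<n x. of_bool (\<forall>i<Suc j. \<not> P x i)) = (LEAST i. P x i)" for x
  proof -
    obtain i where i: "i < n x" "P x i" using assms(3) by blast
    let ?l = "LEAST i. P x i"
    have l: "?l < n x" using i by (meson Least_le le_less_trans)
    have "P x ?l" using i(2) by (rule LeastI)
    then have "(\<forall>i<Suc j. \<not> P x i) \<longleftrightarrow> j < ?l" for j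
      by (metis less_Suc_eq_le not_less_Least not_less order_le_less_trans)
    then have "(\<Sum>j<n x. of_bool (\<forall>i<Suc j. \<not> P x i)) = (\<Sum>j<n x. of_bool (j < ?l) :: nat)"
      by simp
    also have "\<dots> = card {j \<in> {..<n x}. j < ?l}"
      by (simp add: sum.If_cases of_bool_def Int_def)
    also have "{j \<in> {..<n x}. j < ?l} = {..<?l}"
      using l by auto
    finally show ?thesis by simp
  qed
  ultimately show ?thesis by (simp)
qed

text \<open>The state is the accumulator with the remaining list. It stays fixed once the list is
  used up, so surplus rounds do no harm.\<close>

lemma computable_foldl [computable_intros]:
  assumes "computable (\<lambda>p. f (fst p) (fst (snd p)) (snd (snd p)))" "computable a" "computable l"
  shows "computable (\<lambda>x. foldl (f x) (a x) (l x))"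
proof -
  define step where "step = (\<lambda>x (s :: 'b \<times> 'c list).
     case snd s of [] \<Rightarrow> s | y # ys \<Rightarrow> (f x (fst s) y, ys))"
  have step: "computable (\<lambda>p. step (fst p) (snd p))"
    unfolding step_def by (intro computable_intros computable_apply3[OF assms(1)])
  have "computable (\<lambda>x. fst (rec_nat (a x, l x) (\<lambda>_. step x) (enc (l x))))"
    by (intro computable_intros computable_enc assms computable_apply2[OF step])
  moreover have "length ys \<le> n \<Longrightarrow> rec_nat (b, ys) (\<lambda>_. step x) n = (foldl (f x) b ys, [])" for x b ys n
  proof -
    have "rec_nat (b, ys) (\<lambda>_. step x) n = (step x ^^ n) (b, ys)" for b ys n
      by (induction n) auto
    moreover have "length ys \<le> n \<Longrightarrow> (step x ^^ n) (b, ys) = (foldl (f x) b ys, [])" for b ys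
    proof (induction n arbitrary: b ys)
      case (Suc n)
      then show ?case by (cases ys) (auto simp: step_def funpow_Suc_right simp del: funpow.simps)
    qed simp
    ultimately show "length ys \<le> n \<Longrightarrow> ?thesis" by simp
  qed
  ultimately show ?thesis by (simp add: length_le_enc)
qed

section \<open>List operations\<close>

lemma computable_rev [computable_intros]:
  assumes "computable l" shows "computable (\<lambda>x. rev (l x))"
proof -
  have "computable (\<lambda>x. foldl (\<lambda>a y. y # a) [] (l x))" by (intro computable_intros assms)
  moreover have "foldl (\<lambda>a y. y # a) b ys = rev ys @ b" for b ys :: "'b list"
    by (induction ys arbitrary: b) auto
  ultimately show ?thesis by simp
qed

lemma computable_append [computable_intros]:
  assumes "computable l" "computable m" shows "computable (\<lambda>x. l x @ m x)"
proof -
  have "computable (\<lambda>x. foldl (\<lambda>a y. y # a) (m x) (rev (l x)))" by (intro computable_intros assms)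
  moreover have "foldl (\<lambda>a y. y # a) b ys = rev ys @ b" for b ys :: "'b list"
    by (induction ys arbitrary: b) auto
  ultimately show ?thesis by simp
qed

lemma computable_length [computable_intros]:
  assumes "computable l" shows "computable (\<lambda>x. length (l x))"
proof -
  have "computable (\<lambda>x. foldl (\<lambda>a y. Suc a) 0 (l x))" by (intro computable_intros assms)
  moreover have "foldl (\<lambda>a y. Suc a) b ys = length ys + b" for b and ys :: "'b list"
    by (induction ys arbitrary: b) auto
  ultimately show ?thesis by simp
qed

lemma computable_map [computable_intros]:
  assumes "computable (\<lambda>p. f (fst p) (snd p))" "computable l"
  shows "computable (\<lambda>x. map (f x) (l x))"
proof -
  have "computable (\<lambda>x. foldl (\<lambda>a y. a @ [f x y]) [] (l x))"
    by (intro computable_intros assms computable_apply2[OF assms(1)])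
  moreover have "foldl (\<lambda>a y. a @ [f x y]) b ys = b @ map (f x) ys" for b ys x
    by (induction ys arbitrary: b) auto
  ultimately show ?thesis by simp
qed

lemma computable_filter [computable_intros]:
  assumes "computable (\<lambda>p. P (fst p) (snd p))" "computable l"
  shows "computable (\<lambda>x. filter (P x) (l x))"
proof -
  have "computable (\<lambda>x. foldl (\<lambda>a y. if P x y then a @ [y] else a) [] (l x))"
    by (intro computable_intros assms computable_apply2[OF assms(1)])
  moreover have "foldl (\<lambda>a y. if P x y then a @ [y] else a) b ys = b @ filter (P x) ys" for b ys x
    by (induction ys arbitrary: b) auto
  ultimately show ?thesis by simp
qed

lemma computable_concat [computable_intros]:
  assumes "computable l" shows "computable (\<lambda>x. concat (l x))"
proof -
  have "computable (\<lambda>x. foldl (\<lambda>a y. a @ y) [] (l x))" by (intro computable_intros assms)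
  moreover have "foldl (\<lambda>a y. a @ y) b ys = b @ concat ys" for b and ys :: "'b list list"
    by (induction ys arbitrary: b) auto
  ultimately show ?thesis by simp
qed

lemma computable_member [computable_intros]:
  assumes "computable f" "computable l" shows "computable (\<lambda>x. f x \<in> set (l x))"
proof -
  have "computable (\<lambda>x. foldl (\<lambda>a y. a \<or> y = f x) False (l x))"
    by (intro computable_intros assms computable_compose[OF assms(1)])
  moreover have "foldl (\<lambda>a y. a \<or> y = z) b ys \<longleftrightarrow> b \<or> z \<in> set ys" for b z and ys :: "'b list"
    by (induction ys arbitrary: b) auto
  ultimately show ?thesis by simp
qed

lemma computable_Ball_set [computable_intros]:
  assumes "computable (\<lambda>p. P (fst p) (snd p))" "computable l"
  shows "computable (\<lambda>x. \<forall>y\<in>set (l x). P x y)"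
proof -
  have "computable (\<lambda>x. foldl (\<lambda>a y. a \<and> P x y) True (l x))"
    by (intro computable_intros assms computable_apply2[OF assms(1)])
  moreover have "foldl (\<lambda>a y. a \<and> P x y) b ys \<longleftrightarrow> b \<and> (\<forall>y\<in>set ys. P x y)" for b x ys
    by (induction ys arbitrary: b) auto
  ultimately show ?thesis by simp
qed

lemma computable_upt [computable_intros]:
  assumes "computable n" shows "computable (\<lambda>x. [0..<n x])"
proof -
  have "computable (\<lambda>x. rec_nat [] (\<lambda>i r. r @ [i]) (n x))" by (intro computable_intros assms)
  moreover have "rec_nat [] (\<lambda>i r. r @ [i]) m = [0..<m]" for m by (induction m) auto
  ultimately show ?thesis by simp
qed

lemma computable_drop [computable_intros]:
  assumes "computable n" "computable l" shows "computable (\<lambda>x. drop (n x) (l x))"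
proof -
  have "computable (\<lambda>x. rec_nat (l x) (\<lambda>i r. case r of [] \<Rightarrow> [] | y # ys \<Rightarrow> ys) (n x))"
    by (intro computable_intros assms)
  moreover have "rec_nat ys (\<lambda>i r. case r of [] \<Rightarrow> [] | y # ys \<Rightarrow> ys) m = drop m ys" for m and ys :: "'b list"
  proof (induction m)
    case (Suc m)
    have "(case zs of [] \<Rightarrow> [] | y # ys \<Rightarrow> ys) = tl zs" for zs :: "'b list"
      by (cases zs) auto
    then show ?case using Suc by (simp add: drop_Suc tl_drop)
  qed simp
  ultimately show ?thesis by simp
qed

lemma computable_take [computable_intros]:
  assumes "computable n" "computable l" shows "computable (\<lambda>x. take (n x) (l x))"
proof -
  have "computable (\<lambda>x. rec_nat [] (\<lambda>i r. case drop i (l x) of [] \<Rightarrow> r | y # ys \<Rightarrow> r @ [y]) (n x))"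
    by (intro computable_intros assms computable_compose[OF assms(2)])
  moreover have "rec_nat [] (\<lambda>i r. case drop i ys of [] \<Rightarrow> r | y # zs \<Rightarrow> r @ [y]) m = take m ys" for m and ys :: "'b list"
  proof (induction m)
    case (Suc m)
    then show ?case
      by (cases "m < length ys") (auto simp: Cons_nth_drop_Suc[symmetric] take_Suc_conv_app_nth)
  qed simp
  ultimately show ?thesis by simp
qed

lemma computable_div [computable_intros]:
  assumes "computable f" "computable g" shows "computable (\<lambda>x. f x div g x :: nat)"
proof -
  \<comment> \<open>The disjunct \<open>snd p = 0\<close> makes the least number \<open>0\<close>,
    the value of division by zero.\<close>
  have "computable (\<lambda>p. LEAST i. snd p = 0 \<or> fst p < Suc i * snd p)" (is "computable (\<lambda>p. Least (?P p))")
  proof (rule computable_bounded_least)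
    show "computable (\<lambda>q. ?P (fst q) (snd q))" by (intro computable_intros)
    show "computable (\<lambda>p :: nat \<times> nat. Suc (fst p))" by (intro computable_intros)
    show "\<exists>i<Suc (fst p). ?P p i" for p :: "nat \<times> nat"
      by (rule exI[of _ "fst p"]) (cases "snd p", auto)
  qed
  moreover have "(LEAST i. snd p = 0 \<or> fst p < Suc i * snd p) = fst p div snd p" for p :: "nat \<times> nat"
  proof (cases "snd p = 0")
    case False
    then have "snd p = 0 \<or> fst p < Suc i * snd p \<longleftrightarrow> fst p div snd p \<le> i" for i
      using div_less_iff_less_mult[of "snd p" "fst p" "Suc i"] by (simp add: less_Suc_eq_le)
    then show ?thesis
      by (simp add: Least_equality)
  qed simp
  ultimately have "computable (\<lambda>p. fst p div snd p :: nat)" by simp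
  then show ?thesis using assms by (rule computable_apply2)
qed

lemma recursive2_iff_computable:
  "recursive2 f \<longleftrightarrow> computable (\<lambda>p. f (fst p) (snd p))"
proof
  assume "recursive2 f"
  then obtain e where "\<And>x y. rec_eval Map.empty e [x, y] = Some (f x y)"
    by (auto simp: recursive2_def)
  then show "computable (\<lambda>p. f (fst p) (snd p))"
    unfolding computable_def
    by (intro exI[of _ "Comp e [fst_prog, snd_prog]"])
       (auto simp: enc_prod_def enc_nat_def rec_eval_fst_prog rec_eval_snd_prog)
next
  assume "computable (\<lambda>p. f (fst p) (snd p))"
  then obtain e where "\<And>x y. rec_eval Map.empty e [prod_encode (x, y)] = Some (f x y)"
    by (auto simp: computable_def enc_prod_def enc_nat_def)
  then show "recursive2 f"
    unfolding recursive2_def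
    by (intro exI[of _ "Comp e [pair_prog]"]) (auto simp: rec_eval_pair_prog)
qed



section \<open>Computations with a bounded amount of search\<close>

definition string_oracle :: "nat list \<Rightarrow> nat \<rightharpoonup> nat" where
  "string_oracle \<rho> k = (case drop k \<rho> of [] \<Rightarrow> None | y # ys \<Rightarrow> Some y)"

lemma string_oracle_alt: "string_oracle \<rho> k = (if k < length \<rho> then Some (\<rho> ! k) else None)"
  by (auto simp: string_oracle_def Cons_nth_drop_Suc[symmetric])

text \<open>As \<^const>\<open>rec_eval\<close>, except that an unbounded search must succeed within \<open>S\<close>.\<close>

fun search_eval :: "nat set \<Rightarrow> (nat \<rightharpoonup> nat) \<Rightarrow> rec_prog \<Rightarrow> nat list \<rightharpoonup> nat" where
  "search_eval S A Zero xs = Some 0"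
| "search_eval S A Succ xs = (case xs of [] \<Rightarrow> None | x # _ \<Rightarrow> Some (Suc x))"
| "search_eval S A (Proj i) xs = (if i < length xs then Some (xs ! i) else None)"
| "search_eval S A Oracle xs = (case xs of [] \<Rightarrow> None | x # _ \<Rightarrow> A x)"
| "search_eval S A (Comp f gs) xs =
     Option.bind (those (map (\<lambda>g. search_eval S A g xs) gs)) (search_eval S A f)"
| "search_eval S A (PrimRec f g) xs =
     (case xs of [] \<Rightarrow> None
      | n # ys \<Rightarrow> rec_nat (search_eval S A f ys)
          (\<lambda>m r. Option.bind r (\<lambda>v. search_eval S A g (m # v # ys))) n)"
| "search_eval S A (Mu f) xs =
     (if \<exists>n\<in>S. search_eval S A f (n # xs) = Some 0 \<and> (\<forall>i<n. \<exists>w. search_eval S A f (i # xs) = Some (Suc w))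
      then Some (LEAST n. search_eval S A f (n # xs) = Some 0)
      else None)"

lemma least_zero:
  fixes F :: "nat \<Rightarrow> nat option"
  assumes "F n = Some 0" "\<forall>i<n. \<exists>w. F i = Some (Suc w)"
  shows "(LEAST n. F n = Some 0) = n"
proof (rule Least_equality)
  show "n \<le> y" if "F y = Some 0" for y
    using assms(2) that by (cases "y < n") auto
qed (fact assms(1))

text \<open>Positive values, not merely defined ones, are demanded below the witness, so the witness
  is itself the least zero. Freed from \<open>LEAST\<close>, the description is visibly monotone in
  \<open>S\<close> and in the values of \<open>f\<close>.\<close>

lemma search_eval_Mu_iff:
  "search_eval S A (Mu f) xs = Some v \<longleftrightarrow>
     v \<in> S \<and> search_eval S A f (v # xs) = Some 0 \<and> (\<forall>i<v. \<exists>w. search_eval S A f (i # xs) = Some (Suc w))"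
    (is "?L \<longleftrightarrow> ?R v")
proof
  assume L: ?L
  then obtain n where n: "?R n" by (auto split: if_splits)
  then have "search_eval S A (Mu f) xs = Some (LEAST n. search_eval S A f (n # xs) = Some 0)"
    unfolding search_eval.simps(7) by (intro if_P) blast
  moreover have "(LEAST n. search_eval S A f (n # xs) = Some 0) = n"
    using n least_zero[of "\<lambda>n. search_eval S A f (n # xs)" n] by blast
  ultimately have "v = n" using L by simp
  then show "?R v" using n by simp
next
  assume R: "?R v"
  then have "search_eval S A (Mu f) xs = Some (LEAST n. search_eval S A f (n # xs) = Some 0)"
    unfolding search_eval.simps(7) by (intro if_P) blast
  moreover have "(LEAST n. search_eval S A f (n # xs) = Some 0) = v"
    using R least_zero[of "\<lambda>n. search_eval S A f (n # xs)" v] by blast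
  ultimately show ?L by simp
qed

text \<open>In the case of \<open>Mu\<close>, going down to the least zero turns values defined
  below a zero into positive ones.\<close>

lemma search_eval_UNIV: "search_eval UNIV A e xs = rec_eval A e xs"
proof (induction e arbitrary: xs)
  case (Comp f gs)
  have gs: "map (\<lambda>g. search_eval UNIV A g xs) gs = map (\<lambda>g. rec_eval A g xs) gs"
    using Comp.IH(2) by (rule map_cong[OF refl])
  have f: "search_eval UNIV A f = rec_eval A f"
    using Comp.IH(1) by (rule ext)
  show ?case
    unfolding search_eval.simps(5) rec_eval.simps(5) gs f ..
next
  case (PrimRec f g)
  then show ?case by (cases xs) simp_all
next
  case (Mu f)
  let ?F = "\<lambda>n. rec_eval A f (n # xs)"
  have "(\<exists>n. ?F n = Some 0 \<and> (\<forall>i<n. \<exists>w. ?F i = Some (Suc w))) \<longleftrightarrow> (\<exists>n. ?F n = Some 0 \<and> (\<forall>i<n. ?F i \<noteq> None))"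
  proof
    assume "\<exists>n. ?F n = Some 0 \<and> (\<forall>i<n. ?F i \<noteq> None)"
    then obtain n where n: "?F n = Some 0" "\<forall>i<n. ?F i \<noteq> None" by blast
    let ?l = "LEAST n. ?F n = Some 0"
    have "?F ?l = Some 0" "?l \<le> n" using n(1) by (auto intro: LeastI Least_le)
    moreover have "\<exists>w. ?F i = Some (Suc w)" if "i < ?l" for i
    proof -
      have "?F i \<noteq> None" using n(2) that \<open>?l \<le> n\<close> by simp
      then obtain u where "?F i = Some u" by blast
      moreover from this have "u \<noteq> 0" using not_less_Least[OF that] by auto
      ultimately show ?thesis by (metis not0_implies_Suc)
    qed
    ultimately show "\<exists>n. ?F n = Some 0 \<and> (\<forall>i<n. \<exists>w. ?F i = Some (Suc w))" by blast
  next
    assume "\<exists>n. ?F n = Some 0 \<and> (\<forall>i<n. \<exists>w. ?F i = Some (Suc w))"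
    then show "\<exists>n. ?F n = Some 0 \<and> (\<forall>i<n. ?F i \<noteq> None)" by (metis option.distinct(1))
  qed
  then show ?case unfolding search_eval.simps(7) rec_eval.simps(7) Mu.IH bex_UNIV by (simp only:)
qed (simp_all split: list.splits)

lemma those_map_mono:
  assumes "those (map F gs) = Some vs" "\<And>g v. g \<in> set gs \<Longrightarrow> F g = Some v \<Longrightarrow> G g = Some v"
  shows "those (map G gs) = Some vs"
  using assms
proof (induction gs arbitrary: vs)
  case (Cons g gs)
  from Cons.prems(1) obtain y ys where ys: "F g = Some y" "those (map F gs) = Some ys" "vs = y # ys"
    by (auto split: option.splits)
  then have "those (map G gs) = Some ys"
    using Cons.prems(2) by (intro Cons.IH) auto
  then show ?case using ys Cons.prems(2) by simp
qed simp

text \<open>Every clause that yields a value relies on values that are present, never on the absence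
  of one.\<close>

lemma search_eval_mono:
  assumes "S \<subseteq> S'" "A \<subseteq>\<^sub>m A'" "search_eval S A e xs = Some v"
  shows "search_eval S' A' e xs = Some v"
  using assms(3)
proof (induction e arbitrary: xs v)
  case Oracle
  then show ?case using assms(2) by (auto simp: map_le_def split: list.splits) (metis domI)
next
  case (Comp f gs)
  then obtain vs where "those (map (\<lambda>g. search_eval S A g xs) gs) = Some vs" "search_eval S A f vs = Some v"
    by (auto simp: bind_eq_Some_conv)
  moreover from this(1) have "those (map (\<lambda>g. search_eval S' A' g xs) gs) = Some vs"
    by (rule those_map_mono) (use Comp.IH in blast)
  ultimately show ?case using Comp.IH(1) by simp
next
  case (PrimRec f g)
  then obtain n ys where xs: "xs = n # ys" by (cases xs) auto
  have "rec_nat (search_eval S A f ys) (\<lambda>m r. Option.bind r (\<lambda>v. search_eval S A g (m # v # ys))) n = Some v \<Longrightarrow>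
      rec_nat (search_eval S' A' f ys) (\<lambda>m r. Option.bind r (\<lambda>v. search_eval S' A' g (m # v # ys))) n = Some v" for v
    by (induction n arbitrary: v) (auto simp: bind_eq_Some_conv PrimRec.IH)
  then show ?case using PrimRec.prems xs by simp
next
  case (Mu f)
  then show ?case unfolding search_eval_Mu_iff using assms(1) by blast
qed (auto split: list.splits if_splits)

text \<open>A halting computation makes finitely many oracle calls and search steps, so one number
  bounds them all. With \<open>eventually\<close> in the induction the bounds of subcomputations
  combine without explicit maxima.\<close>

lemma search_eval_continuous:
  assumes "rec_eval A e xs = Some v"
  shows "\<exists>s. search_eval {..<s} (A |` {..<s}) e xs = Some v"
proof -
  let ?E = "\<lambda>t. search_eval {..<t} (A |` {..<t})"
  have mono: "?E t e xs = Some v" if "s \<le> t" "?E s e xs = Some v" for s t e xs v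
    by (rule search_eval_mono[OF _ _ that(2)]) (use that(1) in \<open>auto simp: map_le_def restrict_map_def split: if_splits\<close>)
  have "search_eval UNIV A e xs = Some v \<Longrightarrow> \<forall>\<^sub>F t in sequentially. ?E t e xs = Some v"
  proof (induction e arbitrary: xs v)
    case Oracle
    then obtain x ys where xs: "xs = x # ys" "A x = Some v" by (cases xs) auto
    have "\<forall>\<^sub>F t in sequentially. x < t" by (rule eventually_gt_at_top)
    then show ?case by eventually_elim (use xs in simp)
  next
    case (Comp f gs)
    then obtain vs where vs: "those (map (\<lambda>g. search_eval UNIV A g xs) gs) = Some vs"
        "search_eval UNIV A f vs = Some v"
      by (auto simp: bind_eq_Some_conv)
    have "\<forall>\<^sub>F t in sequentially. \<forall>g\<in>set gs. \<forall>v. search_eval UNIV A g xs = Some v \<longrightarrow> ?E t g xs = Some v"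
    proof (rule eventually_ball_finite)
      show "\<forall>g\<in>set gs. \<forall>\<^sub>F t in sequentially. \<forall>v. search_eval UNIV A g xs = Some v \<longrightarrow> ?E t g xs = Some v"
      proof
        fix g assume g: "g \<in> set gs"
        show "\<forall>\<^sub>F t in sequentially. \<forall>v. search_eval UNIV A g xs = Some v \<longrightarrow> ?E t g xs = Some v"
          using Comp.IH(2)[OF g, of xs] by (cases "search_eval UNIV A g xs") auto
      qed
    qed simp
    with Comp.IH(1)[OF vs(2)] show ?case
    proof eventually_elim
      case (elim t)
      then have "those (map (\<lambda>g. ?E t g xs) gs) = Some vs"
        by (intro those_map_mono[OF vs(1)]) blast
      then show ?case using elim by simp
    qed
  next
    case (PrimRec f g)
    then obtain n ys where xs: "xs = n # ys" by (cases xs) auto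
    have "rec_nat (search_eval UNIV A f ys) (\<lambda>m r. Option.bind r (\<lambda>v. search_eval UNIV A g (m # v # ys))) n = Some v \<Longrightarrow>
      \<forall>\<^sub>F t in sequentially. rec_nat (?E t f ys) (\<lambda>m r. Option.bind r (\<lambda>v. ?E t g (m # v # ys))) n = Some v" for v
    proof (induction n arbitrary: v)
      case 0
      then show ?case using PrimRec.IH(1) by simp
    next
      case (Suc n)
      then obtain u where u: "rec_nat (search_eval UNIV A f ys) (\<lambda>m r. Option.bind r (\<lambda>v. search_eval UNIV A g (m # v # ys))) n = Some u"
         "search_eval UNIV A g (n # u # ys) = Some v"
        by (auto simp: bind_eq_Some_conv)
      from Suc.IH[OF u(1)] PrimRec.IH(2)[OF u(2)] show ?case
        by eventually_elim simp
    qed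
    then show ?case using PrimRec.prems xs by simp
  next
    case (Mu f)
    then have "search_eval UNIV A f (v # xs) = Some 0" and
      w: "\<And>i. i < v \<Longrightarrow> \<exists>w. search_eval UNIV A f (i # xs) = Some (Suc w)"
      unfolding search_eval_Mu_iff by auto
    then have "\<forall>\<^sub>F t in sequentially. ?E t f (v # xs) = Some 0" using Mu.IH by blast
    moreover have "\<forall>\<^sub>F t in sequentially. \<forall>i\<in>{..<v}. \<exists>w. ?E t f (i # xs) = Some (Suc w)"
    proof (rule eventually_ball_finite)
      show "\<forall>i\<in>{..<v}. \<forall>\<^sub>F t in sequentially. \<exists>w. ?E t f (i # xs) = Some (Suc w)"
      proof
        fix i assume "i \<in> {..<v}"
        then obtain w where "search_eval UNIV A f (i # xs) = Some (Suc w)" using w by auto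
        from Mu.IH[OF this] show "\<forall>\<^sub>F t in sequentially. \<exists>w. ?E t f (i # xs) = Some (Suc w)"
          by eventually_elim blast
      qed
    qed simp
    moreover have "\<forall>\<^sub>F t in sequentially. v < t" by (rule eventually_gt_at_top)
    ultimately show ?case
      by eventually_elim (simp add: search_eval_Mu_iff del: search_eval.simps)
  qed (auto split: list.splits if_splits)
  then have "\<forall>\<^sub>F t in sequentially. ?E t e xs = Some v"
    using assms by (simp add: search_eval_UNIV)
  then show ?thesis
    by (auto dest: eventually_happens)
qed

lemma computable_string_oracle:
  "computable (\<lambda>p. string_oracle (fst p) (snd p))"
  unfolding string_oracle_def by (intro computable_intros)

lemma computable_bind:
  fixes f :: "'a::enc \<Rightarrow> 'b::enc option" and g :: "'a \<Rightarrow> 'b \<Rightarrow> 'c::enc option"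
  assumes "computable f" "computable (\<lambda>p. g (fst p) (snd p))"
  shows "computable (\<lambda>x. Option.bind (f x) (g x))"
proof -
  have "computable (\<lambda>x. case f x of None \<Rightarrow> None | Some y \<Rightarrow> g x y)"
    by (intro computable_intros assms)
  moreover have "Option.bind z h = (case z of None \<Rightarrow> None | Some y \<Rightarrow> h y)" for z :: "'b option" and h :: "'b \<Rightarrow> 'c option"
    by (cases z) auto
  ultimately show ?thesis by simp
qed

text \<open>With a finite oracle and bounded search the outcome, failure included, is decidable. The
  induction is on a fixed program, each program getting its own evaluator.\<close>

lemma computable_search_eval:
  "computable (\<lambda>p. search_eval {..<fst p} (string_oracle (fst (snd p))) e (snd (snd p)))"
proof (induction e)
  case (Proj i)
  have "computable (\<lambda>p :: nat \<times> nat list \<times> nat list. case drop i (snd (snd p)) of [] \<Rightarrow> None | y # ys \<Rightarrow> Some y)"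
    by (intro computable_intros)
  moreover have "(case drop i xs of [] \<Rightarrow> None | y # ys \<Rightarrow> Some y) = (if i < length xs then Some (xs ! i) else None)"
      for xs :: "nat list"
    by (auto simp: Cons_nth_drop_Suc[symmetric])
  ultimately show ?case by simp
next
  case Oracle
  show ?case
    unfolding search_eval.simps
    by (intro computable_intros computable_apply2[OF computable_string_oracle])
next
  case (Comp f gs)
  have "computable (\<lambda>p. those (map (\<lambda>g. search_eval {..<fst p} (string_oracle (fst (snd p))) g (snd (snd p))) gs))"
    using Comp.IH(2)
  proof (induction gs)
    case Nil
    show ?case by (auto intro: computable_intros)
  next
    case (Cons g gs)
    have g: "computable (\<lambda>p. search_eval {..<fst p} (string_oracle (fst (snd p))) g (snd (snd p)))"
      by (rule Cons.prems) simp
    have gs: "computable (\<lambda>p. those (map (\<lambda>g. search_eval {..<fst p} (string_oracle (fst (snd p))) g (snd (snd p))) gs))"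
      by (rule Cons.IH) (simp add: Cons.prems)
    show ?case
      unfolding list.map those.simps map_option_case
      by (intro computable_intros g computable_compose[OF gs])
  qed
  then show ?case
    unfolding search_eval.simps
    by (intro computable_bind computable_apply3[OF Comp.IH(1)] computable_intros)
next
  case (PrimRec f g)
  show ?case
    unfolding search_eval.simps
    by (intro computable_intros computable_bind computable_apply3[OF PrimRec.IH(1)]
        computable_apply3[OF PrimRec.IH(2)])
next
  case (Mu f)
  let ?E = "\<lambda>p n. search_eval {..<fst p} (string_oracle (fst (snd p))) f (n # snd (snd p))"
  \<comment> \<open>The disjunct \<open>n = fst p\<close> is a sentinel: it makes the least number
    exist, and a search that meets no zero stops at the bound.\<close>
  let ?l = "\<lambda>p. LEAST n. ?E p n = Some 0 \<or> n = fst p"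
  have E: "computable (\<lambda>q. ?E (fst q) (snd q))"
    by (intro computable_intros computable_apply3[OF Mu.IH])
  have l: "computable ?l"
  proof (rule computable_bounded_least)
    show "computable (\<lambda>q. ?E (fst q) (snd q) = Some 0 \<or> snd q = fst (fst q))"
      by (intro computable_intros E)
    show "computable (\<lambda>p :: nat \<times> nat list \<times> nat list. Suc (fst p))"
      by (intro computable_intros)
  qed auto
  have "computable (\<lambda>p. if ?l p < fst p \<and> (\<forall>i<?l p. \<not> ?E p i = None) then Some (?l p) else None)"
    by (intro computable_intros l E)
  moreover have "search_eval {..<fst p} (string_oracle (fst (snd p))) (Mu f) (snd (snd p)) =
     (if ?l p < fst p \<and> (\<forall>i<?l p. \<not> ?E p i = None) then Some (?l p) else None)" (is "?L p = ?R p") for p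
  proof -
    define l where "l = ?l p"
    have l: "?E p l = Some 0 \<or> l = fst p"
      unfolding l_def by (rule LeastI[of _ "fst p"]) blast
    have l_less: "?E p i \<noteq> Some 0 \<and> i \<noteq> fst p" if "i < l" for i
      using not_less_Least[of i "\<lambda>n. ?E p n = Some 0 \<or> n = fst p"] that unfolding l_def by blast
    have "?L p = Some v \<longleftrightarrow> l = v \<and> v < fst p \<and> (\<forall>i<v. \<not> ?E p i = None)" for v
    proof
      assume "?L p = Some v"
      then have v: "v < fst p" "?E p v = Some 0" "\<forall>i<v. \<exists>w. ?E p i = Some (Suc w)"
        unfolding search_eval_Mu_iff by blast+
      moreover have "l = v"
      proof (rule linorder_cases)
        assume "l < v"
        then obtain w where "?E p l = Some (Suc w)" using v(3) by blast
        with l v(1) \<open>l < v\<close> show ?thesis by simp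
      next
        assume "v < l"
        with l_less v(2) show ?thesis by blast
      qed
      ultimately show "l = v \<and> v < fst p \<and> (\<forall>i<v. \<not> ?E p i = None)"
        by (metis option.distinct(1))
    next
      assume v: "l = v \<and> v < fst p \<and> (\<forall>i<v. \<not> ?E p i = None)"
      then have "?E p v = Some 0" using l by blast
      moreover have "\<exists>w. ?E p i = Some (Suc w)" if i: "i < v" for i
      proof -
        obtain u where u: "?E p i = Some u" using v i by blast
        have "?E p i \<noteq> Some 0" using l_less i v by blast
        then show ?thesis using u by (cases u) auto
      qed
      ultimately show "?L p = Some v"
        using v unfolding search_eval_Mu_iff by blast
    qed
    then have L: "?L p = Some v \<longleftrightarrow> l = v \<and> v < fst p \<and> (\<forall>i<v. \<not> ?E p i = None)" for v .
    have "?L p = (if l < fst p \<and> (\<forall>i<l. \<not> ?E p i = None) then Some l else None)"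
    proof (cases "l < fst p \<and> (\<forall>i<l. \<not> ?E p i = None)")
      case True
      then have "?L p = Some l" using L[of l] by blast
      then show ?thesis unfolding if_P[OF True] .
    next
      case False
      then have "?L p \<noteq> Some v" for v using L[of v] by blast
      then have "?L p = None" by (metis option.exhaust)
      then show ?thesis unfolding if_not_P[OF False] .
    qed
    then show ?thesis unfolding l_def .
  qed
  ultimately show ?case by (simp only:)
next
  case Zero
  show ?case unfolding search_eval.simps by (intro computable_intros)
next
  case Succ
  show ?case unfolding search_eval.simps by (intro computable_intros)
qed



section \<open>Bushy trees\<close>

text \<open>The \<open>k\<close>-bigness of \<open>A\<close> above \<tau> from bushy tree forcing,
  with the tree implicit in the derivation. For \<open>k = 0\<close> it always holds by
  \<open>V = {}\<close>, so failure of bigness includes \<open>0 < k\<close>.\<close>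

inductive big :: "(nat \<Rightarrow> nat) \<Rightarrow> nat \<Rightarrow> nat list set \<Rightarrow> nat list \<Rightarrow> bool" for q k A where
  leaf: "\<tau> \<in> A \<Longrightarrow> big q k A \<tau>"
| node: "V \<subseteq> {..<q (length \<tau>)} \<Longrightarrow> k \<le> card V \<Longrightarrow> (\<And>v. v \<in> V \<Longrightarrow> big q k A (\<tau> @ [v])) \<Longrightarrow> big q k A \<tau>"

definition bounded_string :: "(nat \<Rightarrow> nat) \<Rightarrow> nat list \<Rightarrow> bool" where
  "bounded_string q \<rho> \<longleftrightarrow> (\<forall>i<length \<rho>. \<rho> ! i < q i)"

lemma bounded_string_snoc:
  "bounded_string q (\<rho> @ [v]) \<longleftrightarrow> bounded_string q \<rho> \<and> v < q (length \<rho>)"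
  by (auto simp: bounded_string_def nth_append less_Suc_eq)

text \<open>Each child inherits one of the alternatives; among \<open>a + b\<close> children,
  \<open>a\<close> fall on the first side or \<open>b\<close> on the second.\<close>

lemma big_union:
  assumes "big q (a + b) (A \<union> B) \<tau>"
  shows "big q a A \<tau> \<or> big q b B \<tau>"
  using assms
proof (induction rule: big.induct)
  case (leaf \<tau>)
  then show ?case by (auto intro: big.leaf)
next
  case (node V \<tau>)
  define VA where "VA = {v \<in> V. big q a A (\<tau> @ [v])}"
  define VB where "VB = {v \<in> V. big q b B (\<tau> @ [v])}"
  have "V = VA \<union> VB" using node.IH by (auto simp: VA_def VB_def)
  then have "a + b \<le> card VA + card VB"
    using node.hyps(2) card_Un_le[of VA VB] by simp
  then consider "a \<le> card VA" | "b \<le> card VB" by linarith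
  then show ?case
  proof cases
    case 1
    then have "big q a A \<tau>"
      by (rule big.node[rotated]) (use node.hyps(1) in \<open>auto simp: VA_def\<close>)
    then show ?thesis ..
  next
    case 2
    then have "big q b B \<tau>"
      by (rule big.node[rotated]) (use node.hyps(1) in \<open>auto simp: VB_def\<close>)
    then show ?thesis ..
  qed
qed

lemma big_UN:
  assumes "finite I" "I \<noteq> {}" "big q (card I * k) (\<Union>i\<in>I. A i) \<tau>"
  shows "\<exists>i\<in>I. big q k (A i) \<tau>"
  using assms
proof (induction rule: finite_ne_induct)
  case (singleton i)
  then have "big q k (A i) \<tau>"
    by (simp only: card.insert card.empty finite.emptyI empty_iff not_False_eq_True UN_insert
        UN_empty Un_empty_right One_nat_def[symmetric] mult_1)
  then show ?case by blast
next
  case (insert i I)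
  have "card (insert i I) * k = k + card I * k" using insert.hyps by simp
  with insert.prems have "big q (k + card I * k) (A i \<union> (\<Union>i\<in>I. A i)) \<tau>"
    by (simp only: UN_insert)
  from big_union[OF this] show ?case using insert.IH by blast
qed

text \<open>Walk through the tree for \<open>A\<close>, always to a child above which
  \<open>B\<close> is not big; one exists, since otherwise the same children would make
  \<open>B\<close> big at the node. In the forcing this reaches a string in \<open>A\<close> while
  remaining a condition.\<close>

lemma big_leaf_not_big:
  assumes "big q k A \<tau>" "\<not> big q k B \<tau>" "bounded_string q \<tau>"
  shows "\<exists>\<rho>\<in>A. \<not> big q k B \<rho> \<and> bounded_string q \<rho> \<and> take (length \<tau>) \<rho> = \<tau>"
  using assms
proof (induction rule: big.induct)
  case (leaf \<tau>)
  then show ?case by auto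
next
  case (node V \<tau>)
  obtain v where v: "v \<in> V" "\<not> big q k B (\<tau> @ [v])"
    using big.node[of V q \<tau> k B] node.hyps node.prems(1) by blast
  moreover have "bounded_string q (\<tau> @ [v])"
    using v(1) node.hyps(1) node.prems(2) by (auto simp: bounded_string_snoc)
  ultimately obtain \<rho> where \<rho>: "\<rho> \<in> A" "\<not> big q k B \<rho>" "bounded_string q \<rho>"
      "take (length (\<tau> @ [v])) \<rho> = \<tau> @ [v]"
    using node.IH by blast
  have "take (length \<tau>) \<rho> = take (length \<tau>) (take (length (\<tau> @ [v])) \<rho>)"
    by (simp add: min_def)
  also have "\<dots> = \<tau>" using \<rho>(4) by simp
  finally have "take (length \<tau>) \<rho> = \<tau>" .
  then show ?case by (intro bexI[of _ \<rho>] conjI \<rho>(1-3))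
qed

lemma not_big_children:
  assumes "\<not> big q k B \<tau>"
  shows "q (length \<tau>) < card {v \<in> {..<q (length \<tau>)}. \<not> big q k B (\<tau> @ [v])} + k"
proof -
  let ?V = "{v \<in> {..<q (length \<tau>)}. big q k B (\<tau> @ [v])}"
  let ?W = "{v \<in> {..<q (length \<tau>)}. \<not> big q k B (\<tau> @ [v])}"
  have "\<not> k \<le> card ?V"
  proof
    assume "k \<le> card ?V"
    then have "big q k B \<tau>" by (rule big.node[rotated]) auto
    with assms show False ..
  qed
  moreover have "card (?V \<union> ?W) = card ?V + card ?W"
    by (rule card_Un_disjoint) auto
  moreover have "?V \<union> ?W = {..<q (length \<tau>)}" by auto
  ultimately show ?thesis by simp
qed

text \<open>Two different children cannot both hit the single value of \<psi> at their position, so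
  bigness of the hits descends to an actual hit at the node. Hence the forcing can start with
  parameter \<open>2\<close>.\<close>

lemma not_big_hits:
  fixes \<psi> :: "nat \<rightharpoonup> nat"
  assumes "\<tau> \<notin> {\<tau>. \<exists>i<length \<tau>. \<psi> i = Some (\<tau> ! i)}"
  shows "\<not> big q 2 {\<tau>. \<exists>i<length \<tau>. \<psi> i = Some (\<tau> ! i)} \<tau>"
proof -
  let ?B = "{\<tau>. \<exists>i<length \<tau>. \<psi> i = Some (\<tau> ! i)}"
  have "big q 2 ?B \<tau> \<Longrightarrow> \<tau> \<in> ?B"
  proof (induction rule: big.induct)
    case (node V \<tau>)
    show ?case
    proof (rule ccontr)
      assume \<tau>: "\<tau> \<notin> ?B"
      have "\<psi> (length \<tau>) = Some v" if "v \<in> V" for v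
        using node.IH[OF that] \<tau> by (auto simp: nth_append less_Suc_eq split: if_splits)
      then have "is_singleton V \<or> V = {}"
        by (auto simp: is_singleton_def) (metis is_singletonI' is_singleton_def option.inject empty_iff)
      then show False using node.hyps(2) by (auto simp: is_singleton_def)
    qed
  qed
  then show ?thesis using assms by blast
qed

text \<open>The paths of \<open>T\<close> are finite, so the children demanded below eventually lead to \<open>G\<close>.\<close>

definition bushy_certificate :: "(nat \<Rightarrow> nat) \<Rightarrow> nat \<Rightarrow> nat list set \<Rightarrow> nat list set \<Rightarrow> bool" where
  "bushy_certificate q k G T \<longleftrightarrow>
     (\<forall>\<rho>\<in>T. \<rho> \<in> G \<or> k \<le> card {v \<in> {..<q (length \<rho>)}. \<rho> @ [v] \<in> T})"

lemma bushy_certificate_big: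
  assumes "finite T" "bushy_certificate q k G T" "\<rho> \<in> T"
  shows "big q k G \<rho>"
proof -
  obtain N where N: "\<forall>\<rho>\<in>T. length \<rho> \<le> N"
    using assms(1) by (metis finite_imageI finite_nat_set_iff_bounded_le imageI)
  show ?thesis using assms(3)
  proof (induction "N - length \<rho>" arbitrary: \<rho> rule: less_induct)
    case less
    show ?case
    proof (cases "\<rho> \<in> G")
      case True
      then show ?thesis by (rule big.leaf)
    next
      case False
      let ?V = "{v \<in> {..<q (length \<rho>)}. \<rho> @ [v] \<in> T}"
      have "k \<le> card ?V" using False less.prems assms(2) by (auto simp: bushy_certificate_def)
      then show ?thesis
      proof (rule big.node[rotated])
        fix v assume "v \<in> ?V"
        then have "\<rho> @ [v] \<in> T" by simp
        moreover from this have "length (\<rho> @ [v]) \<le> N" using N by blast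
        ultimately show "big q k G (\<rho> @ [v])" by (intro less.hyps) auto
      qed auto
    qed
  qed
qed

lemma bushy_certificate_mono:
  assumes "bushy_certificate q k G T" "G \<subseteq> G'"
  shows "bushy_certificate q k G' T"
  using assms by (auto simp: bushy_certificate_def)

text \<open>Nodes branch finitely, so a derivation of bigness uses finitely many leaves, and one
  stage contains them all. For stages that are uniformly decidable, bigness thereby becomes
  semidecidable.\<close>

lemma big_bushy_certificate:
  assumes "big q k (\<Union>s. G s) \<tau>" "mono G"
  shows "\<exists>(s::nat) T. finite T \<and> \<tau> \<in> T \<and> bushy_certificate q k (G s) T"
  using assms(1)
proof (induction rule: big.induct)
  case (leaf \<tau>)
  then obtain s where "\<tau> \<in> G s" by blast
  then have "finite {\<tau>} \<and> \<tau> \<in> {\<tau>} \<and> bushy_certificate q k (G s) {\<tau>}"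
    by (simp add: bushy_certificate_def)
  then show ?case by blast
next
  case (node V \<tau>)
  then obtain S F where SF: "\<And>v. v \<in> V \<Longrightarrow> finite (F v)" "\<And>v. v \<in> V \<Longrightarrow> \<tau> @ [v] \<in> F v"
    "\<And>v. v \<in> V \<Longrightarrow> bushy_certificate q k (G (S v)) (F v)"
    by metis
  have fin: "finite V" using node.hyps(1) finite_subset by blast
  define s where "s = Max (S ` V)"
  \<comment> \<open>Adding strings never removes a child, so the certificates of the children remain
    valid inside the union.\<close>
  define T where "T = insert \<tau> (\<Union>v\<in>V. F v)"
  have T: "finite T" using fin SF(1) by (simp add: T_def)
  have "\<rho> \<in> G s \<or> k \<le> card {v \<in> {..<q (length \<rho>)}. \<rho> @ [v] \<in> T}" if \<rho>T: "\<rho> \<in> T" for \<rho>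
  proof -
    consider "\<rho> = \<tau>" | v where "v \<in> V" "\<rho> \<in> F v" using \<rho>T unfolding T_def by blast
    then show ?thesis
    proof cases
      case 1
      have "V \<subseteq> {v \<in> {..<q (length \<tau>)}. \<tau> @ [v] \<in> T}"
        using node.hyps(1) SF(2) by (auto simp: T_def)
      then have "card V \<le> card {v \<in> {..<q (length \<tau>)}. \<tau> @ [v] \<in> T}"
        by (intro card_mono) auto
      then show ?thesis using 1 node.hyps(2) by simp
    next
      case 2
      have "S v \<le> s" using fin 2(1) by (simp add: s_def)
      then have "bushy_certificate q k (G s) (F v)"
        using SF(3)[OF 2(1)] bushy_certificate_mono assms(2) by (metis monoD)
      then consider "\<rho> \<in> G s" | "k \<le> card {w \<in> {..<q (length \<rho>)}. \<rho> @ [w] \<in> F v}"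
        using 2(2) unfolding bushy_certificate_def by blast
      then show ?thesis
      proof cases
        case 2
        moreover have "card {w \<in> {..<q (length \<rho>)}. \<rho> @ [w] \<in> F v} \<le> card {w \<in> {..<q (length \<rho>)}. \<rho> @ [w] \<in> T}"
          by (rule card_mono) (use \<open>v \<in> V\<close> in \<open>auto simp: T_def\<close>)
        ultimately show ?thesis by linarith
      qed simp
    qed
  qed
  then have "bushy_certificate q k (G s) T" by (auto simp: bushy_certificate_def)
  then show ?case using T by (metis T_def insertI1)
qed

section \<open>The density of strings above which a set is small\<close>

text \<open>A list, so that it is a computable object and proportions become lengths of filtered
  lists.\<close>

primrec extensions :: "(nat \<Rightarrow> nat) \<Rightarrow> nat list \<Rightarrow> nat \<Rightarrow> nat list list" where
  "extensions q \<tau> 0 = [\<tau>]"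
| "extensions q \<tau> (Suc d) =
     concat (map (\<lambda>\<rho>. map (\<lambda>v. \<rho> @ [v]) [0..<q (length \<rho>)]) (extensions q \<tau> d))"

lemma length_mem_extensions: "\<rho> \<in> set (extensions q \<tau> d) \<Longrightarrow> length \<rho> = length \<tau> + d"
  by (induction d arbitrary: \<rho>) auto

lemma take_mem_extensions: "\<rho> \<in> set (extensions q \<tau> d) \<Longrightarrow> take (length \<tau>) \<rho> = \<tau>"
proof (induction d arbitrary: \<rho>)
  case (Suc d)
  then obtain \<sigma> v where "\<sigma> \<in> set (extensions q \<tau> d)" "\<rho> = \<sigma> @ [v]" by auto
  then show ?case using Suc.IH length_mem_extensions[of \<sigma>] by simp
qed simp

lemma bounded_mem_extensions:
  "bounded_string q \<tau> \<Longrightarrow> \<rho> \<in> set (extensions q \<tau> d) \<Longrightarrow> bounded_string q \<rho>"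
  by (induction d arbitrary: \<rho>) (auto simp: bounded_string_snoc)

lemma length_extensions: "length (extensions q \<tau> d) = (\<Prod>i<d. q (length \<tau> + i))"
proof (induction d)
  case (Suc d)
  have "length (concat (map (\<lambda>\<rho>. map (\<lambda>v. \<rho> @ [v]) [0..<q (length \<rho>)]) L)) = length L * c"
    if "\<forall>\<rho>\<in>set L. q (length \<rho>) = c" for c and L :: "nat list list"
    using that by (induction L) auto
  from this[of "extensions q \<tau> d" "q (length \<tau> + d)"] show ?case
    using Suc by (simp add: length_mem_extensions)
qed simp

text \<open>By \<open>not_big_children\<close> a string of length \<open>n\<close> above which
  \<open>B\<close> is not big has at least \<open>q n - k\<close> such children; the children of
  other strings can be ignored.\<close>

lemma length_filter_not_big:
  assumes "\<not> big q k B \<tau>" "\<forall>n\<ge>length \<tau>. k \<le> q n"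
  shows "(\<Prod>i<d. q (length \<tau> + i) - k) \<le> length (filter (\<lambda>\<rho>. \<not> big q k B \<rho>) (extensions q \<tau> d))"
proof (induction d)
  case (Suc d)
  let ?g = "\<lambda>\<rho>. \<not> big q k B \<rho>"
  have "length (filter ?g L) * (c - k) \<le>
      length (filter ?g (concat (map (\<lambda>\<rho>. map (\<lambda>v. \<rho> @ [v]) [0..<q (length \<rho>)]) L)))"
    if "\<forall>\<rho>\<in>set L. q (length \<rho>) = c" for c and L :: "nat list list"
    using that
  proof (induction L)
    case (Cons \<rho> L)
    have "c - k \<le> length (filter ?g (map (\<lambda>v. \<rho> @ [v]) [0..<q (length \<rho>)]))" if "?g \<rho>"
    proof -
      have "length (filter ?g (map (\<lambda>v. \<rho> @ [v]) [0..<q (length \<rho>)])) =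
          card {v \<in> {..<q (length \<rho>)}. ?g (\<rho> @ [v])}"
        by (subst distinct_card[symmetric])
           (auto simp: distinct_map inj_on_def filter_map intro!: bij_betw_same_card[symmetric]
             bij_betw_imageI[of "\<lambda>v. \<rho> @ [v]"])
      then show ?thesis using not_big_children[OF that] Cons.prems by simp
    qed
    then show ?case using Cons by (cases "?g \<rho>") auto
  qed simp
  from this[of "extensions q \<tau> d" "q (length \<tau> + d)"] show ?case
    using Suc by (simp add: length_mem_extensions) (meson le_trans mult_le_mono1)
qed (use assms(1) in simp)

text \<open>The previous count as a probability for a uniformly random extension. The assumption
  \<open>k \<le> q n\<close> makes truncated and real subtraction agree.\<close>

lemma extensions_density:
  assumes "\<not> big q k B \<tau>" "\<forall>n\<ge>length \<tau>. k \<le> q n" "\<forall>n. 0 < q n"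
  shows "(\<Prod>i<d. 1 - real k / real (q (length \<tau> + i))) * real (length (extensions q \<tau> d))
    \<le> real (length (filter (\<lambda>\<rho>. \<not> big q k B \<rho>) (extensions q \<tau> d)))"
proof -
  have "(\<Prod>i<d. 1 - real k / real (q (length \<tau> + i))) * real (length (extensions q \<tau> d)) =
      (\<Prod>i<d. (1 - real k / real (q (length \<tau> + i))) * real (q (length \<tau> + i)))"
    by (simp add: length_extensions prod.distrib)
  also have "\<dots> = (\<Prod>i<d. real (q (length \<tau> + i) - k))"
  proof (rule prod.cong)
    fix i
    have "q (length \<tau> + i) > 0" "k \<le> q (length \<tau> + i)" using assms by auto
    then show "(1 - real k / real (q (length \<tau> + i))) * real (q (length \<tau> + i)) = real (q (length \<tau> + i) - k)"
      by (simp add: of_nat_diff field_simps)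
  qed simp
  also have "\<dots> \<le> real (length (filter (\<lambda>\<rho>. \<not> big q k B \<rho>) (extensions q \<tau> d)))"
    using length_filter_not_big[OF assms(1,2), of d] by (simp flip: of_nat_prod)
  finally show ?thesis .
qed

section \<open>A slow-growing bound adapted to a modulus of depth\<close>

text \<open>The position \<open>l(m)\<close>, where block \<open>m\<close> begins. The block has
  \<open>2 ^ r m\<close> places, which cancels the factor \<open>2 ^ r m\<close> of the bound on it,
  so the growth of \<open>r\<close> drops out of the sum of reciprocals.\<close>

definition block_start :: "(nat \<Rightarrow> nat) \<Rightarrow> nat \<Rightarrow> nat" where
  "block_start r m = (\<Sum>j<m. 2 ^ r j)"

definition block :: "(nat \<Rightarrow> nat) \<Rightarrow> nat \<Rightarrow> nat" where
  "block r i = (LEAST m. i < block_start r (Suc m))"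

text \<open>Block \<open>m\<close> contributes \<open>1 / (m + 2)\<close> to the sum of the reciprocals.\<close>

definition block_bound :: "(nat \<Rightarrow> nat) \<Rightarrow> nat \<Rightarrow> nat" where
  "block_bound r i = (block r i + 2) * 2 ^ r (block r i)"

lemma block_start_Suc: "block_start r (Suc m) = block_start r m + 2 ^ r m"
  by (simp add: block_start_def)

lemma block_start_mono: "m \<le> n \<Longrightarrow> block_start r m \<le> block_start r n"
  unfolding block_start_def by (intro sum_mono2) auto

lemma le_block_start: "m \<le> block_start r m"
proof (induction m)
  case (Suc m)
  have "(1::nat) \<le> 2 ^ r m" by simp
  then have "Suc m \<le> block_start r m + 2 ^ r m" using Suc by linarith
  then show ?case by (simp only: block_start_Suc)
qed simp

lemma less_block_start_Suc_block: "i < block_start r (Suc (block r i))"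
  unfolding block_def by (rule LeastI[of _ i]) (use le_block_start[of "Suc i" r] in simp)

lemma block_eqI:
  assumes "block_start r m \<le> i" "i < block_start r (Suc m)"
  shows "block r i = m"
  unfolding block_def
proof (rule Least_equality)
  show "m \<le> n" if "i < block_start r (Suc n)" for n
    using that assms(1) block_start_mono[of "Suc n" m r] by (cases "n < m") auto
qed (fact assms(2))

lemma block_mono: "i \<le> j \<Longrightarrow> block r i \<le> block r j"
  unfolding block_def[of r i] by (rule Least_le) (use less_block_start_Suc_block[of j r] in simp)

lemma block_ge: "block_start r m \<le> i \<Longrightarrow> m \<le> block r i"
  using less_block_start_Suc_block[of i r] block_start_mono[of "Suc (block r i)" m r]
  by (cases "m \<le> block r i") auto

lemma block_bound_ge:
  assumes "mono r" "block_start r m \<le> i"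
  shows "(m + 2) * 2 ^ r m \<le> block_bound r i"
proof -
  have "m \<le> block r i" using assms(2) by (rule block_ge)
  then show ?thesis
    unfolding block_bound_def by (intro mult_mono power_increasing) (auto intro: monoD[OF assms(1)])
qed

lemma block_bound_mono: "mono r \<Longrightarrow> mono (block_bound r)"
  unfolding block_bound_def
  by (intro monoI mult_mono power_increasing) (auto simp: block_mono intro: monoD)

lemma block_bound_ge_2: "2 \<le> block_bound r i"
proof -
  have "2 * 1 \<le> (block r i + 2) * 2 ^ r (block r i)" by (intro mult_mono) auto
  then show ?thesis by (simp add: block_bound_def)
qed

section \<open>Divergence of the reciprocals, and the density kept by the blocks\<close>

lemma sum_inverse_block_bound:
  "(\<Sum>i<block_start r m. inverse (real (block_bound r i))) = (\<Sum>j<m. inverse (real (j + 2)))"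
proof (induction m)
  case (Suc m)
  have "{..<block_start r (Suc m)} = {..<block_start r m} \<union> {block_start r m..<block_start r (Suc m)}"
    using block_start_mono[of m "Suc m" r] by auto
  then have "(\<Sum>i<block_start r (Suc m). inverse (real (block_bound r i))) =
      (\<Sum>i<block_start r m. inverse (real (block_bound r i))) +
      (\<Sum>i\<in>{block_start r m..<block_start r (Suc m)}. inverse (real (block_bound r i)))"
    by (simp add: sum.union_disjoint ivl_disj_int)
  also have "(\<Sum>i\<in>{block_start r m..<block_start r (Suc m)}. inverse (real (block_bound r i))) =
      (\<Sum>i\<in>{block_start r m..<block_start r (Suc m)}. inverse (real ((m + 2) * 2 ^ r m)))"
    by (intro sum.cong) (auto simp: block_bound_def block_eqI)
  also have "\<dots> = real (2 ^ r m) * inverse (real (m + 2) * real (2 ^ r m))"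
    by (simp only: sum_constant card_atLeastLessThan block_start_Suc add_diff_cancel_left' of_nat_mult)
  also have "\<dots> = inverse (real (m + 2))"
    by (simp only: inverse_mult_distrib) simp
  finally show ?case using Suc by simp
qed (simp add: block_start_def)

lemma suminf_inverse_block_bound:
  "(\<Sum>i. ennreal (inverse (real (block_bound r i)))) = \<infinity>"
proof (rule ccontr)
  assume "(\<Sum>i. ennreal (inverse (real (block_bound r i)))) \<noteq> \<infinity>"
  then have s: "summable (\<lambda>i. inverse (real (block_bound r i)))"
    by (intro summable_suminf_not_top) auto
  have "summable (\<lambda>j. inverse (real (j + 2)))"
  proof (rule summableI_nonneg_bounded)
    show "(\<Sum>j<m. inverse (real (j + 2))) \<le> (\<Sum>i. inverse (real (block_bound r i)))" for m
      unfolding sum_inverse_block_bound[of r m, symmetric] by (rule sum_le_suminf[OF s]) auto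
  qed simp
  then have "summable (\<lambda>j. inverse (real j))"
    using summable_iff_shift[of "\<lambda>j. inverse (real j)" 2] by simp
  then show False using not_summable_harmonic[where 'a = real] by simp
qed

text \<open>Within block \<open>m\<close> the factor is constant and occurs \<open>2 ^ r m\<close>
  times, so the Bernoulli inequality bounds its contribution from below by
  \<open>1 - k / (m + 2)\<close>. The assumption on \<open>j\<close> makes this at least
  \<open>3 / 4\<close> from block \<open>j\<close> on.\<close>

lemma prod_block_bound_ge:
  assumes "4 * k \<le> j + 2" "j \<le> m"
  shows "(3 / 4) ^ (m - j) \<le>
    (\<Prod>i<block_start r m - block_start r j. 1 - real k / real (block_bound r (block_start r j + i)))"
  using assms(2)
proof (induction m rule: dec_induct)
  case (step m)
  let ?f = "\<lambda>i. 1 - real k / real (block_bound r i)"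
  let ?s = "block_start r"
  have eq: "(\<Prod>i<?s n - ?s j. ?f (?s j + i)) = prod ?f {?s j..<?s n}" if "j \<le> n" for n
    using prod.shift_bounds_nat_ivl[of ?f 0 "?s j" "?s n - ?s j"] block_start_mono[OF that, of r]
    by (simp add: lessThan_atLeast0 add.commute)
  let ?x = "real k / real ((m + 2) * 2 ^ r m)"
  have k4: "4 * real k \<le> real m + 2" using assms(1) step.hyps by linarith
  have "?x \<le> real k / real (m + 2)"
  proof (rule frac_le)
    have "(m + 2) * 1 \<le> (m + 2) * 2 ^ r m" by (rule mult_le_mono2) simp
    then have "m + 2 \<le> (m + 2) * 2 ^ r m" by (simp only: mult_1_right)
    then show "real (m + 2) \<le> real ((m + 2) * 2 ^ r m)" by (simp only: of_nat_le_iff)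
  qed simp_all
  also have "\<dots> \<le> 1" using k4 by simp
  finally have x: "?x \<le> 1" .
  have cancel: "c * (a / (b * c)) = a / b" if "c \<noteq> 0" for a b c :: real
    using that by simp
  have "3 / 4 \<le> 1 - real k / real (m + 2)" using k4 by (simp add: field_simps)
  also have "real k / real (m + 2) = real (2 ^ r m) * ?x"
    unfolding of_nat_mult by (rule cancel[symmetric]) simp
  also have "1 - real (2 ^ r m) * ?x = 1 + real (2 ^ r m) * (- ?x)" by simp
  also have "\<dots> \<le> (1 + (- ?x)) ^ (2 ^ r m)"
    by (rule Bernoulli_inequality) (use x in simp)
  also have "\<dots> = (\<Prod>i\<in>{?s m..<?s (Suc m)}. 1 - ?x)"
    by (simp add: block_start_Suc)
  also have "\<dots> = prod ?f {?s m..<?s (Suc m)}"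
    by (intro prod.cong) (auto simp: block_bound_def block_eqI)
  finally have b: "3 / 4 \<le> prod ?f {?s m..<?s (Suc m)}" .
  have "(3 / 4) ^ (Suc m - j) = (3 / 4) ^ (m - j) * (3 / 4 :: real)"
    using step.hyps by (simp add: Suc_diff_le)
  also have "\<dots> \<le> prod ?f {?s j..<?s m} * prod ?f {?s m..<?s (Suc m)}"
    using step.IH b unfolding eq[OF step.hyps(1)] by (intro mult_mono) (auto intro: order_trans[rotated])
  also have "\<dots> = prod ?f {?s j..<?s (Suc m)}"
    by (rule prod.atLeastLessThan_concat) (use step.hyps in \<open>auto intro: block_start_mono\<close>)
  finally show ?case using eq[of "Suc m"] step.hyps by simp
qed simp



section \<open>Effective real-valued data\<close>

text \<open>A code with denominator \<open>0\<close> stands for \<open>0\<close> on both sides, by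
  the conventions for \<open>Fract\<close> and for division.\<close>

lemma of_rat_nat_to_rat_surj:
  "of_rat (nat_to_rat_surj c) =
     (of_int (int_decode (fst (prod_decode c))) / of_int (int_decode (snd (prod_decode c))) :: real)"
  by (cases "int_decode (snd (prod_decode c)) = 0")
     (simp_all add: nat_to_rat_surj_def case_prod_unfold of_rat_rat rat_number_collapse Let_def)

text \<open>Even numbers \<open>2 * a\<close> code the nonnegative integers under
  \<open>int_decode\<close>; hence the doubling wherever a fraction is turned into a code.\<close>

lemma nat_to_rat_surj_quotient:
  "of_rat (nat_to_rat_surj (prod_encode (2 * a, 2 * b))) = (real a / real b :: real)"
  by (simp add: of_rat_nat_to_rat_surj int_decode_def sum_decode_def)

lemma abs_int_decode: "\<bar>int_decode a\<bar> = int (Suc a div 2)"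
  by (auto simp: int_decode_def sum_decode_def elim!: evenE oddE)

text \<open>Rounding \<open>A / B\<close> to the nearest integer is
  \<open>(2 * A + B) div (2 * B)\<close>, and an error of \<open>1 / 4\<close> determines the
  result. Signs may be dropped, as \<open>\<bar>x\<bar>\<close> is no further than \<open>x\<close>
  from a natural number.\<close>

lemma nearest_nat:
  assumes "\<bar>real j - of_rat (nat_to_rat_surj c)\<bar> \<le> 1 / 4"
  shows "j = (2 * (Suc (fst (prod_decode c)) div 2) + Suc (snd (prod_decode c)) div 2)
    div (2 * (Suc (snd (prod_decode c)) div 2))"
proof -
  define A B where "A = Suc (fst (prod_decode c)) div 2" and "B = Suc (snd (prod_decode c)) div 2"
  have "\<bar>of_rat (nat_to_rat_surj c) :: real\<bar> = real A / real B"
    unfolding of_rat_nat_to_rat_surj abs_divide A_def B_def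
    by (simp only: of_int_abs[symmetric] abs_int_decode of_int_of_nat_eq)
  then have j: "\<bar>real j - real A / real B\<bar> \<le> 1 / 4" using assms by linarith
  show ?thesis
  proof (cases "B = 0")
    \<comment> \<open>The rational is then \<open>0\<close>, which forces \<open>j = 0\<close>; the
      right side is a division by zero, also \<open>0\<close>.\<close>
    case True
    then have "real j \<le> 1 / 4" using j by simp
    then show ?thesis using True by (simp flip: B_def)
  next
    case False
    have "\<bar>real j - real A / real B\<bar> * real B = \<bar>(real j - real A / real B) * real B\<bar>"
      by (simp add: abs_mult)
    also have "(real j - real A / real B) * real B = real j * real B - real A"
      using False by (simp add: left_diff_distrib)
    finally have "\<bar>real j - real A / real B\<bar> * real B = \<bar>real j * real B - real A\<bar>" .
    moreover have "\<bar>real j - real A / real B\<bar> * real B \<le> 1 / 4 * real B"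
      using j by (intro mult_right_mono) auto
    ultimately have "\<bar>real (j * B) - real A\<bar> \<le> real B / 4" by simp
    then have "real (j * B) - real A \<le> real B / 4" "- (real (j * B) - real A) \<le> real B / 4"
      unfolding abs_le_iff by blast+
    then have "4 * real (j * B) \<le> 4 * real A + real B" "4 * real A \<le> 4 * real (j * B) + real B"
      by linarith+
    then have *: "4 * (j * B) \<le> 4 * A + B" "4 * A \<le> 4 * (j * B) + B"
      by linarith+
    have "(2 * A + B) div (2 * B) = j"
    proof (rule div_nat_eqI)
      show "2 * B * j \<le> 2 * A + B" using * by (simp add: mult.commute mult.left_commute)
      show "2 * A + B < 2 * B * Suc j" using * False by (simp add: mult.commute mult.left_commute)
    qed
    then show ?thesis by (simp only: A_def B_def)
  qed
qed

lemma computable_prod_decode [computable_intros]: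
  assumes "computable f" shows "computable (\<lambda>x. prod_decode (f x))"
  by (rule computable_cong_enc[OF assms]) (simp add: enc_prod_def enc_nat_def)

lemma computable_list_decode [computable_intros]:
  assumes "computable f" shows "computable (\<lambda>x. list_decode (f x))"
proof -
  have "map enc xs = xs" for xs :: "nat list" by (induction xs) (simp_all add: enc_nat_def)
  then show ?thesis
    by (intro computable_cong_enc[OF assms]) (simp add: enc_list_def enc_nat_def)
qed

lemma computable_prod_encode [computable_intros]:
  assumes "computable f" "computable g" shows "computable (\<lambda>x. prod_encode (f x, g x))"
  by (rule computable_cong_enc[OF computable_Pair[OF assms]]) (simp add: enc_prod_def enc_nat_def)

lemma computable_nat_order_function:
  assumes "order_function (\<lambda>n. real (r n))"
  shows "computable r"
proof -
  obtain f where f: "recursive2 f" "\<And>n k. \<bar>real (r n) - of_rat (nat_to_rat_surj (f n k))\<bar> \<le> 1 / 2 ^ k"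
    using assms by (auto simp: order_function_def computable_real_seq_def)
  let ?B = "\<lambda>n. Suc (snd (prod_decode (f n 2))) div 2"
  have r: "r = (\<lambda>n. (2 * (Suc (fst (prod_decode (f n 2))) div 2) + ?B n) div (2 * ?B n))"
    by (intro ext nearest_nat) (use f(2)[of _ 2] in simp)
  show ?thesis
    by (subst r) (intro computable_intros computable_apply2[OF f(1)[unfolded recursive2_iff_computable]])
qed

lemma computable_block_start:
  assumes "computable r" shows "computable (block_start r)"
proof -
  have "computable (\<lambda>m. \<Sum>j<m. 2 ^ r j :: nat)"
    by (intro computable_intros computable_compose[OF assms])
  then show ?thesis by (simp add: block_start_def[abs_def])
qed

lemma computable_block_bound:
  assumes "computable r" shows "computable (block_bound r)"
proof -
  have "computable (block r)"
    unfolding block_def[abs_def]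
  proof (rule computable_bounded_least)
    show "computable (\<lambda>p. fst p < block_start r (Suc (snd p)))"
      by (intro computable_intros computable_compose[OF computable_block_start[OF assms]])
    show "computable Suc" by (intro computable_intros)
    show "\<exists>m<Suc i. i < block_start r (Suc m)" for i
      using le_block_start[of "Suc i" r] by auto
  qed
  then have "computable (\<lambda>i. (block r i + 2) * 2 ^ r (block r i))"
    by (intro computable_intros computable_compose[OF assms])
  then show ?thesis by (simp add: block_bound_def[abs_def])
qed

lemma slow_growing_block_bound:
  assumes "computable r" "mono r"
  shows "slow_growing (\<lambda>i. real (block_bound r i))"
proof -
  have "recursive2 (\<lambda>n k. prod_encode (2 * block_bound r n, 2 * 1))"
    unfolding recursive2_iff_computable
    by (intro computable_intros computable_compose[OF computable_block_bound[OF assms(1)]])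
  then have "computable_real_seq (\<lambda>i. real (block_bound r i))"
    unfolding computable_real_seq_def
    by (intro exI[of _ "\<lambda>n k. prod_encode (2 * block_bound r n, 2 * 1)"] conjI)
       (simp_all only: nat_to_rat_surj_quotient, simp)
  moreover have "mono (\<lambda>i. real (block_bound r i))"
    using block_bound_mono[OF assms(2)] by (auto simp: mono_def)
  moreover have "\<exists>n. C < real (block_bound r n)" for C
  proof -
    obtain m where m: "C < real m" using reals_Archimedean2 by blast
    have "m * 1 \<le> (m + 2) * 2 ^ r m" by (intro mult_mono) auto
    also have "\<dots> \<le> block_bound r (block_start r m)" by (rule block_bound_ge[OF assms(2)]) simp
    finally have "m \<le> block_bound r (block_start r m)" by simp
    then show ?thesis using m by (intro exI[of _ "block_start r m"]) linarith
  qed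
  moreover have "1 < real (block_bound r n)" for n
    using block_bound_ge_2[of r n] by linarith
  ultimately show ?thesis
    using suminf_inverse_block_bound[of r] by (simp add: slow_growing_def order_function_def)
qed

text \<open>A left inverse of \<open>string_code\<close> defined on all numbers: every entry other
  than \<open>1\<close> is read as \<open>False\<close>.\<close>

definition bits_decode :: "nat \<Rightarrow> bool list" where
  "bits_decode n = map (\<lambda>x. x = 1) (list_decode n)"

lemma bits_decode_string_code: "bits_decode (string_code \<sigma>) = \<sigma>"
  by (simp add: bits_decode_def string_code_def comp_def of_bool_eq_1_iff)

lemma computable_bits_decode [computable_intros]:
  assumes "computable f" shows "computable (\<lambda>x. bits_decode (f x))"
  unfolding bits_decode_def by (intro computable_intros assms)

section \<open>A mixture of empirical distributions as a semimeasure\<close>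

text \<open>Read \<open>c m s \<sigma>\<close> as the number, among \<open>N m\<close> samples of
  level \<open>m\<close>, known by stage \<open>s\<close> to extend \<sigma>. Each level is a
  semimeasure except for its value at the root, and the weights \<open>(3 / 4) ^ m / 4\<close> add
  up to \<open>1\<close>.\<close>

lemma mixture_semimeasure:
  fixes c :: "nat \<Rightarrow> nat \<Rightarrow> bool list \<Rightarrow> nat" and N :: "nat \<Rightarrow> nat"
  assumes comp_c: "computable (\<lambda>p. c (fst p) (fst (snd p)) (snd (snd p)))"
    and comp_N: "computable N"
    and N: "\<And>m. 0 < N m" and c_le: "\<And>m s \<sigma>. c m s \<sigma> \<le> N m"
    and c_mono: "\<And>m s s' \<sigma>. s \<le> s' \<Longrightarrow> c m s \<sigma> \<le> c m s' \<sigma>"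
    and c_split: "\<And>m s \<sigma>. c m s (\<sigma> @ [False]) + c m s (\<sigma> @ [True]) \<le> c m s \<sigma>"
  shows "\<exists>\<nu>. continuous_semimeasure \<nu> \<and> left_re \<nu> \<and>
    (\<forall>m s \<sigma>. (3 / 4) ^ m / 4 * (real (c m s \<sigma>) / real (N m)) \<le> \<nu> \<sigma>)"
proof -
  define w :: "nat \<Rightarrow> real" where "w m = (3 / 4) ^ m / 4" for m
  define S where "S s \<sigma> = (\<Sum>m<s. w m * (real (c m s \<sigma>) / real (N m)))" for s \<sigma>
  \<comment> \<open>A semimeasure must be \<open>1\<close> at the root, while the samples may reach
    less; raising the root keeps the inequality there.\<close>
  define \<mu> where "\<mu> s \<sigma> = (if \<sigma> = [] then 1 else S s \<sigma>)" for s \<sigma>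
  have w_pos: "0 \<le> w m" for m by (simp add: w_def)
  have w_sum: "(\<Sum>m<s. w m) \<le> 1" for s
  proof -
    have "(\<Sum>m<s. w m) = 1 - (3 / 4) ^ s"
      by (induction s) (simp_all add: w_def)
    then show ?thesis by simp
  qed
  have S_nonneg: "0 \<le> S s \<sigma>" for s \<sigma>
    unfolding S_def by (intro sum_nonneg mult_nonneg_nonneg w_pos) auto
  have S_le: "S s \<sigma> \<le> 1" for s \<sigma>
  proof -
    have "S s \<sigma> \<le> (\<Sum>m<s. w m * 1)"
      unfolding S_def by (intro sum_mono mult_left_mono w_pos) (use c_le N in auto)
    then show ?thesis using w_sum[of s] by simp
  qed
  have S_split: "S s (\<sigma> @ [False]) + S s (\<sigma> @ [True]) \<le> S s \<sigma>" for s \<sigma>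
  proof -
    have "S s (\<sigma> @ [False]) + S s (\<sigma> @ [True]) =
        (\<Sum>m<s. w m * (real (c m s (\<sigma> @ [False]) + c m s (\<sigma> @ [True])) / real (N m)))"
      unfolding S_def sum.distrib[symmetric] by (simp add: add_divide_distrib distrib_left)
    also have "\<dots> \<le> S s \<sigma>"
      unfolding S_def by (intro sum_mono mult_left_mono w_pos divide_right_mono) (use c_split in \<open>simp_all only: of_nat_le_iff of_nat_0_le_iff\<close>)
    finally show ?thesis .
  qed
  have S_mono: "S s \<sigma> \<le> S s' \<sigma>" if "s \<le> s'" for s s' \<sigma>
  proof -
    have "S s \<sigma> \<le> (\<Sum>m<s. w m * (real (c m s' \<sigma>) / real (N m)))"
      unfolding S_def by (intro sum_mono mult_left_mono w_pos divide_right_mono) (use c_mono[OF that] in auto)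
    also have "\<dots> \<le> S s' \<sigma>"
      unfolding S_def by (rule sum_mono2) (use that w_pos in auto)
    finally show ?thesis .
  qed
  have \<mu>_inc: "incseq (\<lambda>s. \<mu> s \<sigma>)" for \<sigma>
    by (auto simp: \<mu>_def incseq_def intro: S_mono)
  have \<mu>_bounds: "0 \<le> \<mu> s \<sigma>" "\<mu> s \<sigma> \<le> 1" for s \<sigma>
    using S_nonneg S_le by (auto simp: \<mu>_def)
  define \<nu> where "\<nu> \<sigma> = lim (\<lambda>s. \<mu> s \<sigma>)" for \<sigma>
  have lim: "(\<lambda>s. \<mu> s \<sigma>) \<longlonglongrightarrow> \<nu> \<sigma>" for \<sigma>
  proof -
    obtain L where "(\<lambda>s. \<mu> s \<sigma>) \<longlonglongrightarrow> L"
      by (rule incseq_convergent[OF \<mu>_inc]) (use \<mu>_bounds(2) in blast)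
    then show ?thesis unfolding \<nu>_def by (simp add: limI)
  qed
  have "continuous_semimeasure \<nu>"
    unfolding continuous_semimeasure_def
  proof (intro conjI allI)
    fix \<sigma>
    show "0 \<le> \<nu> \<sigma>" by (rule LIMSEQ_le_const[OF lim]) (use \<mu>_bounds in blast)
    show "\<nu> \<sigma> \<le> 1" by (rule LIMSEQ_le_const2[OF lim]) (use \<mu>_bounds in blast)
    have "\<mu> s (\<sigma> @ [False]) + \<mu> s (\<sigma> @ [True]) \<le> \<mu> s \<sigma>" for s
      using S_split[of s \<sigma>] S_le[of s \<sigma>] by (cases "\<sigma> = []") (simp_all add: \<mu>_def)
    then show "\<nu> (\<sigma> @ [False]) + \<nu> (\<sigma> @ [True]) \<le> \<nu> \<sigma>"
      by (intro LIMSEQ_le[OF tendsto_add[OF lim lim] lim]) blast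
  next
    show "\<nu> [] = 1" using lim[of "[]"] by (simp add: \<mu>_def LIMSEQ_const_iff)
  qed
  moreover have "left_re \<nu>"
  proof -
    \<comment> \<open>The weight \<open>w m\<close> is \<open>3 ^ m / 4 ^ Suc m\<close>, so
      \<open>D m\<close> is a denominator for level \<open>m\<close>; \<open>R\<close> accumulates
      an unreduced numerator and denominator.\<close>
    define D where "D m = 4 ^ Suc m * N m" for m
    define R where "R s \<sigma> = rec_nat (0, 1) (\<lambda>m p. (fst p * D m + 3 ^ m * c m s \<sigma> * snd p, snd p * D m))" for s \<sigma>
    define f where "f n s = (if bits_decode n = [] then prod_encode (2 * 1, 2 * 1)
      else prod_encode (2 * fst (R s (bits_decode n) s), 2 * snd (R s (bits_decode n) s)))" for n s
    have D: "0 < D m" for m using N by (simp add: D_def)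
    have R: "snd (R s \<sigma> t) > 0 \<and> real (fst (R s \<sigma> t)) / real (snd (R s \<sigma> t)) = (\<Sum>m<t. w m * (real (c m s \<sigma>) / real (N m)))" for s \<sigma> t
    proof (induction t)
      case (Suc t)
      define a b where "a = fst (R s \<sigma> t)" and "b = snd (R s \<sigma> t)"
      have b: "b > 0" and ab: "real a / real b = (\<Sum>m<t. w m * (real (c m s \<sigma>) / real (N m)))"
        using Suc by (simp_all add: a_def b_def)
      have step: "R s \<sigma> (Suc t) = (a * D t + 3 ^ t * c t s \<sigma> * b, b * D t)"
        by (simp add: R_def a_def b_def)
      have "real (a * D t + 3 ^ t * c t s \<sigma> * b) / real (b * D t) = real a / real b + 3 ^ t * real (c t s \<sigma>) / real (D t)"
        using b D[of t] by (simp add: field_simps)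
      also have "3 ^ t * real (c t s \<sigma>) / real (D t) = w t * (real (c t s \<sigma>) / real (N t))"
        by (simp add: D_def w_def power_divide)
      finally show ?case using b D[of t] step ab by simp
    qed (simp add: R_def)
    have f_val: "of_rat (nat_to_rat_surj (f (string_code \<sigma>) s)) = \<mu> s \<sigma>" for \<sigma> s
    proof (cases "\<sigma> = []")
      case True
      then have "f (string_code \<sigma>) s = prod_encode (2 * 1, 2 * 1)"
        by (simp only: f_def bits_decode_string_code refl if_True)
      then show ?thesis
        using True nat_to_rat_surj_quotient[of 1 1] by (simp only: \<mu>_def) simp
    next
      case False
      then show ?thesis
        using R[of s \<sigma> s] by (simp add: f_def \<mu>_def S_def bits_decode_string_code nat_to_rat_surj_quotient)
    qed
    have comp_D: "computable D"
      unfolding D_def[abs_def] by (intro computable_intros comp_N)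
    have comp_R: "computable (\<lambda>p. R (fst p) (fst (snd p)) (snd (snd p)))"
      unfolding R_def by (intro computable_intros computable_apply3[OF comp_c] computable_compose[OF comp_D])
    have "recursive2 f"
      unfolding recursive2_iff_computable f_def
      by (intro computable_intros computable_apply3[OF comp_R])
    moreover have "incseq (\<lambda>s. nat_to_rat_surj (f (string_code \<sigma>) s))" for \<sigma>
    proof (rule incseq_SucI)
      fix s
      have "(of_rat (nat_to_rat_surj (f (string_code \<sigma>) s)) :: real) \<le> of_rat (nat_to_rat_surj (f (string_code \<sigma>) (Suc s)))"
        unfolding f_val using \<mu>_inc by (rule incseq_SucD)
      then show "nat_to_rat_surj (f (string_code \<sigma>) s) \<le> nat_to_rat_surj (f (string_code \<sigma>) (Suc s))"
        by (simp add: of_rat_less_eq)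
    qed
    ultimately show ?thesis
      unfolding left_re_def by (intro exI[of _ f]) (simp add: f_val lim)
  qed
  moreover have "w m * (real (c m s \<sigma>) / real (N m)) \<le> \<nu> \<sigma>" for m s \<sigma>
  proof -
    \<comment> \<open>Stage \<open>s\<close> covers only the levels below \<open>s\<close>, so it is
      enlarged until level \<open>m\<close> takes part.\<close>
    let ?t = "max s (Suc m)"
    have "w m * (real (c m s \<sigma>) / real (N m)) \<le> w m * (real (c m ?t \<sigma>) / real (N m))"
      using c_mono[of s ?t m \<sigma>] by (intro mult_left_mono divide_right_mono w_pos) auto
    also have "\<dots> \<le> S ?t \<sigma>"
      unfolding S_def by (rule member_le_sum) (use w_pos in auto)
    also have "\<dots> \<le> \<mu> ?t \<sigma>" using S_le by (simp add: \<mu>_def)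
    also have "\<dots> \<le> \<nu> \<sigma>" using \<mu>_inc lim by (rule incseq_le)
    finally show ?thesis .
  qed
  ultimately show ?thesis unfolding w_def by blast
qed



section \<open>Searching for bushy trees that force a value\<close>

text \<open>The string is a partial oracle that diverges beyond its end, so an output it produces
  persists under all extensions.\<close>

definition forced :: "rec_prog \<Rightarrow> bool list \<Rightarrow> nat list set" where
  "forced e \<sigma> = {\<rho>. \<forall>i<length \<sigma>. rec_eval (string_oracle \<rho>) e [i] = Some (of_bool (\<sigma> ! i))}"

definition forced_by :: "rec_prog \<Rightarrow> bool list \<Rightarrow> nat \<Rightarrow> nat list set" where
  "forced_by e \<sigma> s =
     {\<rho>. \<forall>i<length \<sigma>. search_eval {..<s} (string_oracle \<rho>) e [i] = Some (of_bool (\<sigma> ! i))}"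

section \<open>Forced outputs as an increasing union of decidable stages\<close>

lemma search_eval_continuous_initial:
  assumes "\<forall>i<n. rec_eval A e [i] = Some (f i)"
  shows "\<exists>s. \<forall>i<n. search_eval {..<s} (A |` {..<s}) e [i] = Some (f i)"
  using assms
proof (induction n)
  case (Suc n)
  then obtain s where s: "\<forall>i<n. search_eval {..<s} (A |` {..<s}) e [i] = Some (f i)" by auto
  obtain t where t: "search_eval {..<t} (A |` {..<t}) e [n] = Some (f n)"
    using search_eval_continuous Suc.prems by blast
  have mono: "search_eval {..<max s t} (A |` {..<max s t}) e xs = Some v"
    if "search_eval {..<u} (A |` {..<u}) e xs = Some v" "u \<le> max s t" for u xs v
    by (rule search_eval_mono[OF _ _ that(1)])
       (use that(2) in \<open>auto simp: map_le_def restrict_map_def split: if_splits\<close>)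
  have "search_eval {..<max s t} (A |` {..<max s t}) e [i] = Some (f i)" if "i < Suc n" for i
  proof (cases "i = n")
    case True
    then show ?thesis using mono[OF t] by simp
  next
    case False
    then show ?thesis using mono[of s] s that by simp
  qed
  then show ?case by blast
qed simp

lemma forced_by_mono: "mono (forced_by e \<sigma>)"
proof (rule monoI)
  fix s t :: nat assume "s \<le> t"
  then have "search_eval {..<t} (string_oracle \<rho>) e xs = Some v"
    if "search_eval {..<s} (string_oracle \<rho>) e xs = Some v" for \<rho> xs v
    by (intro search_eval_mono[OF _ _ that]) auto
  then show "forced_by e \<sigma> s \<le> forced_by e \<sigma> t" by (auto simp: forced_by_def)
qed

lemma forced_eq_UN: "forced e \<sigma> = (\<Union>s. forced_by e \<sigma> s)"
proof
  show "(\<Union>s. forced_by e \<sigma> s) \<subseteq> forced e \<sigma>"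
  proof -
    have "rec_eval (string_oracle \<rho>) e xs = Some v"
      if "search_eval {..<s} (string_oracle \<rho>) e xs = Some v" for s \<rho> xs v
      using search_eval_mono[OF subset_UNIV map_le_refl that] by (simp only: search_eval_UNIV)
    then show ?thesis by (auto simp: forced_by_def forced_def)
  qed
  show "forced e \<sigma> \<subseteq> (\<Union>s. forced_by e \<sigma> s)"
  proof
    fix \<rho> assume "\<rho> \<in> forced e \<sigma>"
    then obtain s where s: "\<forall>i<length \<sigma>. search_eval {..<s} (string_oracle \<rho> |` {..<s}) e [i] = Some (of_bool (\<sigma> ! i))"
      using search_eval_continuous_initial[of "length \<sigma>" "string_oracle \<rho>" e "\<lambda>i. of_bool (\<sigma> ! i)"]
      by (auto simp: forced_def)
    have "search_eval {..<s} (string_oracle \<rho>) e [i] = Some (of_bool (\<sigma> ! i))" if "i < length \<sigma>" for i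
      by (rule search_eval_mono[OF order_refl _ s[rule_format, OF that]])
         (auto simp: map_le_def restrict_map_def split: if_splits)
    then have "\<rho> \<in> forced_by e \<sigma> s" by (simp add: forced_by_def)
    then show "\<rho> \<in> (\<Union>s. forced_by e \<sigma> s)" by blast
  qed
qed

lemma string_oracle_append: "string_oracle \<rho> \<subseteq>\<^sub>m string_oracle (\<rho> @ \<rho>')"
  by (auto simp: map_le_def string_oracle_alt nth_append split: if_splits)

lemma rec_eval_mono:
  "A \<subseteq>\<^sub>m A' \<Longrightarrow> rec_eval A e xs = Some v \<Longrightarrow> rec_eval A' e xs = Some v"
  using search_eval_mono[of UNIV UNIV A A' e xs v] by (simp only: search_eval_UNIV order_refl)

lemma forced_append: "\<rho> \<in> forced e \<sigma> \<Longrightarrow> \<rho> @ \<rho>' \<in> forced e \<sigma>"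
  unfolding forced_def using rec_eval_mono[OF string_oracle_append] by blast

lemma computable_forced_by:
  "computable (\<lambda>p. snd (snd p) \<in> forced_by e (fst p) (fst (snd p)))"
proof -
  have "computable (\<lambda>p. \<forall>i<length (fst p). case drop i (fst p) of [] \<Rightarrow> True
      | b # bs \<Rightarrow> search_eval {..<fst (snd p)} (string_oracle (snd (snd p))) e [i] = Some (of_bool b))"
    by (intro computable_intros computable_apply3[OF computable_search_eval])
  moreover have "(snd (snd p) \<in> forced_by e (fst p) (fst (snd p))) \<longleftrightarrow>
    (\<forall>i<length (fst p). case drop i (fst p) of [] \<Rightarrow> True
      | b # bs \<Rightarrow> search_eval {..<fst (snd p)} (string_oracle (snd (snd p))) e [i] = Some (of_bool b))" for p
    by (auto simp: forced_by_def Cons_nth_drop_Suc[symmetric])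
  ultimately show ?thesis by (simp only:)
qed

lemma computable_bushy_certificate:
  assumes "computable q"
  shows "computable (\<lambda>p. bushy_certificate q k (forced_by e (fst p) (fst (snd p))) (set (snd (snd p))))"
proof -
  have "computable (\<lambda>p. \<forall>\<rho>\<in>set (snd (snd p)). \<rho> \<in> forced_by e (fst p) (fst (snd p)) \<or>
      k \<le> (\<Sum>v<q (length \<rho>). of_bool (\<rho> @ [v] \<in> set (snd (snd p)))))"
    by (intro computable_intros computable_apply3[OF computable_forced_by] computable_compose[OF assms])
  moreover have "card {v \<in> {..<n}. P v} = (\<Sum>v<n. of_bool (P v))" for n :: nat and P
    by (simp add: sum.If_cases of_bool_def Int_def)
  ultimately show ?thesis by (simp add: bushy_certificate_def)
qed

lemma computable_extensions:
  assumes "computable q" "computable d"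
  shows "computable (\<lambda>x. extensions q \<tau> (d x))"
proof -
  have "computable (\<lambda>x. rec_nat [\<tau>] (\<lambda>_ L.
      concat (map (\<lambda>\<rho>. map (\<lambda>v. \<rho> @ [v]) [0..<q (length \<rho>)]) L)) (d x))"
    by (intro computable_intros assms(2) computable_compose[OF assms(1)])
  moreover have "rec_nat [\<tau>] (\<lambda>_ L. concat (map (\<lambda>\<rho>. map (\<lambda>v. \<rho> @ [v]) [0..<q (length \<rho>)]) L)) n =
      extensions q \<tau> n" for n
    by (induction n) auto
  ultimately show ?thesis by simp
qed

text \<open>The first success is kept for ever: counts of successes can only grow, and no string
  ever votes for two outputs.\<close>

primrec first_some :: "(nat \<Rightarrow> 'a option) \<Rightarrow> nat \<Rightarrow> 'a option" where
  "first_some F 0 = None"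
| "first_some F (Suc s) = (case first_some F s of None \<Rightarrow> F s | Some y \<Rightarrow> Some y)"

lemma first_some_SomeD: "first_some F s = Some y \<Longrightarrow> \<exists>t. F t = Some y"
  by (induction s) (auto split: option.splits)

lemma first_some_mono:
  assumes "s \<le> s'" "first_some F s = Some y"
  shows "first_some F s' = Some y"
  using assms by (induction s' rule: dec_induct) auto

lemma computable_first_some:
  assumes "computable (\<lambda>p. F (fst p) (snd p))" "computable s"
  shows "computable (\<lambda>x. first_some (F x) (s x))"
proof -
  have "computable (\<lambda>x. rec_nat None (\<lambda>i r. case r of None \<Rightarrow> F x i | Some y \<Rightarrow> Some y) (s x))"
    by (intro computable_intros assms(2) computable_apply2[OF assms(1)])
  moreover have "rec_nat None (\<lambda>i r. case r of None \<Rightarrow> F x i | Some y \<Rightarrow> Some y) n = first_some (F x) n" for x n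
    by (induction n) (auto split: option.splits)
  ultimately show ?thesis by simp
qed

lemma first_some_exists:
  assumes "F t = Some y"
  shows "\<exists>z. first_some F (Suc t) = Some z"
  using assms by (cases "first_some F t") auto

definition strings_decode :: "nat \<Rightarrow> nat list list" where
  "strings_decode n = map list_decode (list_decode n)"

lemma ex_strings_decode: "\<exists>n. strings_decode n = T"
  by (rule exI[of _ "list_encode (map list_encode T)"]) (simp add: strings_decode_def comp_def)

text \<open>The number \<open>t\<close> codes an output, a stage and a finite set of strings
  proposed as a certificate. Semidecidable bigness thus becomes a search through decidable
  tests.\<close>

definition candidate :: "(nat \<Rightarrow> nat) \<Rightarrow> (nat \<Rightarrow> nat) \<Rightarrow> nat \<Rightarrow> rec_prog \<Rightarrow> nat \<Rightarrow> nat list \<Rightarrow> nat \<Rightarrow> bool list option" where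
  "candidate r q k e m \<rho> t =
    (if length (bits_decode (fst (prod_decode t))) = r m \<and>
        \<rho> \<in> set (strings_decode (snd (prod_decode (snd (prod_decode t))))) \<and>
        bushy_certificate q k
          (forced_by e (bits_decode (fst (prod_decode t))) (fst (prod_decode (snd (prod_decode t)))))
          (set (strings_decode (snd (prod_decode (snd (prod_decode t))))))
     then Some (bits_decode (fst (prod_decode t))) else None)"

lemma candidate_sound:
  assumes "candidate r q k e m \<rho> t = Some \<sigma>"
  shows "length \<sigma> = r m \<and> big q k (forced e \<sigma>) \<rho>"
proof -
  define s T where "s = fst (prod_decode (snd (prod_decode t)))"
    and "T = set (strings_decode (snd (prod_decode (snd (prod_decode t)))))"
  have *: "length \<sigma> = r m" "\<rho> \<in> T" "bushy_certificate q k (forced_by e \<sigma> s) T"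
    using assms by (auto simp: candidate_def s_def T_def split: if_splits)
  have "bushy_certificate q k (forced e \<sigma>) T"
    by (rule bushy_certificate_mono[OF *(3)]) (auto simp: forced_eq_UN)
  then have "big q k (forced e \<sigma>) \<rho>"
    by (rule bushy_certificate_big[rotated]) (use *(2) in \<open>auto simp: T_def\<close>)
  with *(1) show ?thesis ..
qed

lemma candidate_complete:
  assumes "length \<sigma> = r m" "big q k (forced e \<sigma>) \<rho>"
  shows "\<exists>t. candidate r q k e m \<rho> t = Some \<sigma>"
proof -
  obtain s T where T: "finite T" "\<rho> \<in> T" "bushy_certificate q k (forced_by e \<sigma> s) T"
    using big_bushy_certificate[OF assms(2)[unfolded forced_eq_UN] forced_by_mono] by blast
  obtain L where L: "set L = T" using T(1) finite_list by blast
  obtain n where n: "strings_decode n = L" using ex_strings_decode by blast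
  have "candidate r q k e m \<rho> (prod_encode (string_code \<sigma>, prod_encode (s, n))) = Some \<sigma>"
    using assms(1) T L n by (simp add: candidate_def bits_decode_string_code)
  then show ?thesis ..
qed

lemma computable_candidate:
  assumes "computable r" "computable q"
  shows "computable (\<lambda>p. candidate r q k e (fst p) (fst (snd p)) (snd (snd p)))"
  unfolding candidate_def strings_decode_def
  by (intro computable_intros computable_compose[OF assms(1)]
      computable_apply3[OF computable_bushy_certificate[OF assms(2)]])

lemma length_filter_split:
  assumes "\<And>\<rho>. \<not> (P \<rho> \<and> Q \<rho>)" "\<And>\<rho>. P \<rho> \<or> Q \<rho> \<Longrightarrow> R \<rho>"
  shows "length (filter P L) + length (filter Q L) \<le> length (filter R L)"
  using assms by (induction L) auto

lemma length_filter_le_sum: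
  assumes "finite F" "\<forall>\<rho>\<in>set L. g \<rho> \<longrightarrow> (\<exists>\<sigma>\<in>F. H \<rho> \<sigma>)"
  shows "length (filter g L) \<le> (\<Sum>\<sigma>\<in>F. length (filter (\<lambda>\<rho>. H \<rho> \<sigma>) L))"
  using assms(2)
proof (induction L)
  case (Cons \<rho> L)
  have "(\<Sum>\<sigma>\<in>F. length (filter (\<lambda>\<rho>. H \<rho> \<sigma>) (\<rho> # L))) =
      (\<Sum>\<sigma>\<in>F. of_bool (H \<rho> \<sigma>)) + (\<Sum>\<sigma>\<in>F. length (filter (\<lambda>\<rho>. H \<rho> \<sigma>) L))"
    by (subst sum.distrib[symmetric]) (rule sum.cong, auto)
  moreover have "of_bool (g \<rho>) \<le> (\<Sum>\<sigma>\<in>F. of_bool (H \<rho> \<sigma>) :: nat)"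
  proof (cases "g \<rho>")
    case True
    then obtain \<sigma> where "\<sigma> \<in> F" "H \<rho> \<sigma>" using Cons.prems by auto
    then show ?thesis
      using member_le_sum[of \<sigma> F "\<lambda>\<sigma>. of_bool (H \<rho> \<sigma>) :: nat"] assms(1) by simp
  qed simp
  moreover have "length (filter g (\<rho> # L)) = of_bool (g \<rho>) + length (filter g L)" by simp
  ultimately show ?case using Cons by (simp del: filter.simps)
qed simp

text \<open>Each extension votes for the first output found to be big above it. As the search may
  stop at any such output, \<open>F\<close> has to contain all of them for the strings counted by
  \<open>g\<close>. The semimeasure is fixed before \<open>g\<close>, so \<open>g\<close> may be
  undecidable.\<close>

lemma bushy_semimeasure:
  assumes "computable r" "computable q" "computable d" "\<forall>n. 0 < q n"
  shows "\<exists>\<nu>. continuous_semimeasure \<nu> \<and> left_re \<nu> \<and>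
    (\<forall>m F g. finite F \<longrightarrow>
      (\<forall>\<rho>\<in>set (extensions q \<tau> (d m)). g \<rho> \<longrightarrow>
        (\<exists>\<sigma>. length \<sigma> = r m \<and> big q k (forced e \<sigma>) \<rho>) \<and>
        (\<forall>\<sigma>. length \<sigma> = r m \<longrightarrow> big q k (forced e \<sigma>) \<rho> \<longrightarrow> \<sigma> \<in> F)) \<longrightarrow>
      (3 / 4) ^ m / 4 * (real (length (filter g (extensions q \<tau> (d m)))) / real (length (extensions q \<tau> (d m))))
        \<le> (\<Sum>\<sigma>\<in>F. \<nu> \<sigma>))"
proof -
  define found where "found m s \<rho> = first_some (candidate r q k e m \<rho>) s" for m s \<rho>
  \<comment> \<open>A vote counts for every prefix of the output found. A longer \<sigma> gets none,
    because \<open>take\<close> then returns the shorter output.\<close>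
  define hit where "hit m s \<sigma> \<rho> = (case found m s \<rho> of None \<Rightarrow> False | Some \<sigma>' \<Rightarrow> take (length \<sigma>) \<sigma>' = \<sigma>)" for m s \<sigma> \<rho>
  let ?E = "\<lambda>m. extensions q \<tau> (d m)"
  define c where "c m s \<sigma> = length (filter (hit m s \<sigma>) (?E m))" for m s \<sigma>
  have comp_found: "computable (\<lambda>p. found (fst p) (fst (snd p)) (snd (snd p)))"
    unfolding found_def
    by (intro computable_first_some computable_intros computable_apply3[OF computable_candidate[OF assms(1,2)]])
  have comp_c: "computable (\<lambda>p. c (fst p) (fst (snd p)) (snd (snd p)))"
    unfolding c_def hit_def
    by (intro computable_intros computable_apply3[OF comp_found] computable_extensions
        computable_compose[OF assms(3)] assms(2))
  have hit_mono: "hit m s' \<sigma> \<rho>" if le: "s \<le> s'" and h: "hit m s \<sigma> \<rho>" for m s s' \<sigma> \<rho>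
  proof -
    obtain \<sigma>' where \<sigma>': "found m s \<rho> = Some \<sigma>'" "take (length \<sigma>) \<sigma>' = \<sigma>"
      using h by (auto simp: hit_def split: option.splits)
    from \<sigma>'(1) have "found m s' \<rho> = Some \<sigma>'"
      unfolding found_def by (rule first_some_mono[OF le])
    then show ?thesis using \<sigma>'(2) by (simp add: hit_def)
  qed
  have ex: "\<exists>\<nu>. continuous_semimeasure \<nu> \<and> left_re \<nu> \<and>
      (\<forall>m s \<sigma>. (3 / 4) ^ m / 4 * (real (c m s \<sigma>) / real (length (?E m))) \<le> \<nu> \<sigma>)"
  proof (rule mixture_semimeasure[OF comp_c])
    show "computable (\<lambda>m. length (?E m))"
      by (intro computable_intros computable_extensions assms)
    show "0 < length (?E m)" for m
      using assms(4) by (simp add: length_extensions)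
    show "c m s \<sigma> \<le> length (?E m)" for m s \<sigma>
      by (simp add: c_def)
    show "c m s \<sigma> \<le> c m s' \<sigma>" if "s \<le> s'" for m s s' \<sigma>
      unfolding c_def using length_filter_split[of "\<lambda>_. False" "hit m s \<sigma>" "hit m s' \<sigma>" "?E m"] hit_mono[OF that]
      by simp
    show "c m s (\<sigma> @ [False]) + c m s (\<sigma> @ [True]) \<le> c m s \<sigma>" for m s \<sigma>
      unfolding c_def
    proof (rule length_filter_split)
      have take: "take (length \<sigma>) \<sigma>' = \<sigma>" if "take (length (\<sigma> @ [b])) \<sigma>' = \<sigma> @ [b]" for \<sigma>' b
      proof -
        have "take (length \<sigma>) \<sigma>' = take (length \<sigma>) (take (length (\<sigma> @ [b])) \<sigma>')"
          by (simp add: min_def)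
        also have "\<dots> = \<sigma>" unfolding that by simp
        finally show ?thesis .
      qed
      show "\<not> (hit m s (\<sigma> @ [False]) \<rho> \<and> hit m s (\<sigma> @ [True]) \<rho>)" for \<rho>
        by (auto simp: hit_def split: option.splits)
      show "hit m s \<sigma> \<rho>" if "hit m s (\<sigma> @ [False]) \<rho> \<or> hit m s (\<sigma> @ [True]) \<rho>" for \<rho>
        using that take by (auto simp: hit_def split: option.splits)
    qed
  qed
  then obtain \<nu> where \<nu>: "continuous_semimeasure \<nu>" "left_re \<nu>"
    "\<And>m s \<sigma>. (3 / 4) ^ m / 4 * (real (c m s \<sigma>) / real (length (?E m))) \<le> \<nu> \<sigma>" by blast
  have "(3 / 4) ^ m / 4 * (real (length (filter g (?E m))) / real (length (?E m))) \<le> (\<Sum>\<sigma>\<in>F. \<nu> \<sigma>)"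
    if fin: "finite F" and
      ex: "\<And>\<rho>. \<rho> \<in> set (?E m) \<Longrightarrow> g \<rho> \<Longrightarrow> \<exists>\<sigma>. length \<sigma> = r m \<and> big q k (forced e \<sigma>) \<rho>" and
      inF: "\<And>\<rho> \<sigma>. \<rho> \<in> set (?E m) \<Longrightarrow> g \<rho> \<Longrightarrow> length \<sigma> = r m \<Longrightarrow> big q k (forced e \<sigma>) \<rho> \<Longrightarrow> \<sigma> \<in> F"
    for m F g
  proof -
    have "\<forall>\<rho>\<in>{\<rho> \<in> set (?E m). g \<rho>}. \<exists>s. \<exists>\<sigma>. found m s \<rho> = Some \<sigma>"
    proof
      fix \<rho> assume "\<rho> \<in> {\<rho> \<in> set (?E m). g \<rho>}"
      then obtain \<sigma> where "length \<sigma> = r m" "big q k (forced e \<sigma>) \<rho>" using ex by blast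
      then obtain t where "candidate r q k e m \<rho> t = Some \<sigma>" using candidate_complete[of \<sigma> r m q k e \<rho>] by blast
      then show "\<exists>s. \<exists>\<sigma>. found m s \<rho> = Some \<sigma>"
        unfolding found_def using first_some_exists[of "candidate r q k e m \<rho>" t] by blast
    qed
    then obtain S where S: "\<And>\<rho>. \<rho> \<in> set (?E m) \<Longrightarrow> g \<rho> \<Longrightarrow> \<exists>\<sigma>. found m (S \<rho>) \<rho> = Some \<sigma>"
      by (metis (mono_tags, lifting) mem_Collect_eq)
    define s where "s = Max (S ` set (?E m))"
    have hits: "\<exists>\<sigma>\<in>F. hit m s \<sigma> \<rho>" if \<rho>: "\<rho> \<in> set (?E m)" "g \<rho>" for \<rho>
    proof -
      obtain \<sigma> where \<sigma>: "found m (S \<rho>) \<rho> = Some \<sigma>" using S \<rho> by blast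
      moreover have "S \<rho> \<le> s" unfolding s_def using \<rho> by simp
      ultimately have "found m s \<rho> = Some \<sigma>" unfolding found_def by (rule first_some_mono[rotated])
      then have "hit m s \<sigma> \<rho>" by (simp add: hit_def)
      moreover have "length \<sigma> = r m \<and> big q k (forced e \<sigma>) \<rho>"
        using first_some_SomeD[OF \<sigma>[unfolded found_def]] candidate_sound by blast
      ultimately show ?thesis using inF \<rho> by blast
    qed
    have "length (filter g (?E m)) \<le> (\<Sum>\<sigma>\<in>F. c m s \<sigma>)"
      unfolding c_def using length_filter_le_sum[OF fin, of "?E m" g "\<lambda>\<rho> \<sigma>. hit m s \<sigma> \<rho>"] hits by simp
    then have "real (length (filter g (?E m))) \<le> (\<Sum>\<sigma>\<in>F. real (c m s \<sigma>))"
      by (simp flip: of_nat_sum)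
    then have "(3 / 4) ^ m / 4 * (real (length (filter g (?E m))) / real (length (?E m))) \<le>
        (3 / 4) ^ m / 4 * ((\<Sum>\<sigma>\<in>F. real (c m s \<sigma>)) / real (length (?E m)))"
      by (intro mult_left_mono divide_right_mono) auto
    also have "\<dots> = (\<Sum>\<sigma>\<in>F. (3 / 4) ^ m / 4 * (real (c m s \<sigma>) / real (length (?E m))))"
      by (simp only: sum_divide_distrib sum_distrib_left)
    also have "\<dots> \<le> (\<Sum>\<sigma>\<in>F. \<nu> \<sigma>)" by (intro sum_mono \<nu>(3))
    finally show ?thesis .
  qed
  then show ?thesis using \<nu>(1,2) by (intro exI[of _ \<nu>] conjI allI impI) blast+
qed



section \<open>Avoiding a deep class\<close>

lemma string_oracle_initial: "string_oracle (map Y [0..<s]) = (\<lambda>n. Some (Y n)) |` {..<s}"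
  by (auto simp: fun_eq_iff string_oracle_alt restrict_map_def)

lemma initial_forced:
  assumes "\<forall>i<length \<sigma>. rec_eval (\<lambda>n. Some (Y n)) e [i] = Some (of_bool (\<sigma> ! i))"
  shows "\<exists>s. map Y [0..<s] \<in> forced e \<sigma>"
proof -
  obtain s where s: "\<forall>i<length \<sigma>. search_eval {..<s} ((\<lambda>n. Some (Y n)) |` {..<s}) e [i] = Some (of_bool (\<sigma> ! i))"
    using search_eval_continuous_initial[OF assms] by blast
  then have "map Y [0..<s] \<in> forced_by e \<sigma> s"
    by (simp add: forced_by_def string_oracle_initial)
  then show ?thesis unfolding forced_eq_UN by blast
qed

lemma forced_initial:
  assumes "map Y [0..<s] \<in> forced e \<sigma>" "i < length \<sigma>"
  shows "rec_eval (\<lambda>n. Some (Y n)) e [i] = Some (of_bool (\<sigma> ! i))"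
proof (rule rec_eval_mono)
  show "string_oracle (map Y [0..<s]) \<subseteq>\<^sub>m (\<lambda>n. Some (Y n))"
    by (auto simp: string_oracle_initial map_le_def restrict_map_def split: if_splits)
qed (use assms in \<open>simp add: forced_def\<close>)

text \<open>At each node fewer than \<open>k\<close> children are lost and at least \<open>k\<close>
  are there. It carries the stem of a condition to the start of a block.\<close>

lemma ex_not_big_extension:
  assumes "\<not> big q k B \<tau>" "\<forall>n\<ge>length \<tau>. k \<le> q n"
  shows "\<exists>\<rho>\<in>set (extensions q \<tau> d). \<not> big q k B \<rho>"
proof (induction d)
  case (Suc d)
  then obtain \<rho> where \<rho>: "\<rho> \<in> set (extensions q \<tau> d)" "\<not> big q k B \<rho>" by blast
  let ?W = "{v \<in> {..<q (length \<rho>)}. \<not> big q k B (\<rho> @ [v])}"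
  have "k \<le> q (length \<rho>)" using assms(2) length_mem_extensions[OF \<rho>(1)] by simp
  then have "0 < card ?W" using not_big_children[OF \<rho>(2)] by linarith
  then obtain v where v: "v \<in> ?W" by (metis card.empty equals0I less_irrefl)
  then have "\<rho> @ [v] \<in> set (extensions q \<tau> (Suc d))" using \<rho>(1) by (auto intro!: bexI[of _ \<rho>])
  then show ?case using v by blast
qed (use assms(1) in simp)

text \<open>A forcing condition \<open>(\<tau>, B, k)\<close> promises that the generic sequence extends \<open>\<tau>\<close> and has no
  initial segment in \<open>B\<close>.\<close>

definition condition :: "(nat \<Rightarrow> nat) \<Rightarrow> nat list \<times> nat list set \<times> nat \<Rightarrow> bool" where
  "condition q = (\<lambda>(\<tau>, B, k). bounded_string q \<tau> \<and> \<not> big q k B \<tau> \<and> (\<forall>n\<ge>length \<tau>. k \<le> q n) \<and>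
     (\<forall>\<rho> \<rho>'. \<rho> \<in> B \<longrightarrow> \<rho> @ \<rho>' \<in> B))"

text \<open>The parameter \<open>k\<close> may change freely. Strict growth of the stem makes the
  limit of successive conditions total.\<close>

definition strengthens :: "nat list \<times> nat list set \<times> nat \<Rightarrow> nat list \<times> nat list set \<times> nat \<Rightarrow> bool" where
  "strengthens = (\<lambda>(\<tau>', B', k') (\<tau>, B, k). take (length \<tau>) \<tau>' = \<tau> \<and> length \<tau> < length \<tau>' \<and> B \<subseteq> B')"

text \<open>One requirement of the construction: program \<open>e\<close> computes no member of
  \<open>P\<close>. The assumed lack of a strengthening is used twice, once to get convergence on a
  big set and once to place every output that is big into the initial segments of \<open>P\<close>;
  counting then contradicts depth.\<close>

lemma condition_forces_avoidance:
  fixes M :: "bool list \<Rightarrow> real" and P :: "(nat \<Rightarrow> bool) set"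
  assumes univ: "universal_semimeasure M"
    and deep: "\<And>n. (\<Sum>\<sigma>\<in>(\<lambda>X. init_seg X (r n)) ` P. M \<sigma>) \<le> 1 / 2 ^ n"
    and r: "computable r" "mono r"
    and cond: "condition (block_bound r) (\<tau>, B, k)"
  shows "\<exists>\<tau>' B' k'. condition (block_bound r) (\<tau>', B', k') \<and> strengthens (\<tau>', B', k') (\<tau>, B, k) \<and>
    (\<forall>Y. map Y [0..<length \<tau>'] = \<tau>' \<longrightarrow> (\<forall>n. map Y [0..<n] \<notin> B') \<longrightarrow>
      (\<forall>X\<in>P. \<exists>n. rec_eval (\<lambda>k. Some (Y k)) e [n] \<noteq> Some (baire_of X n)))"
    (is "\<exists>\<tau>' B' k'. _ \<and> _ \<and> ?avoids \<tau>' B'")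
proof (rule ccontr)
  assume contra: "\<nexists>\<tau>' B' k'. condition (block_bound r) (\<tau>', B', k') \<and> strengthens (\<tau>', B', k') (\<tau>, B, k) \<and> ?avoids \<tau>' B'"
  let ?q = "block_bound r"
  have \<tau>: "bounded_string ?q \<tau>" "\<not> big ?q k B \<tau>" "\<forall>n\<ge>length \<tau>. k \<le> ?q n"
    and B: "\<And>\<rho> \<rho>'. \<rho> \<in> B \<Longrightarrow> \<rho> @ \<rho>' \<in> B"
    using cond by (auto simp: condition_def)
  \<comment> \<open>The part \<open>4 * k\<close> yields the density \<open>3 / 4\<close> per block
    and the room used in \<open>q_ge\<close>; \<open>Suc (length \<tau>)\<close> puts block
    \<open>j\<close> strictly beyond the stem.\<close>
  define j where "j = 4 * k + Suc (length \<tau>)"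
  have len_j: "length \<tau> < block_start r j" using le_block_start[of j r] by (simp add: j_def)
  obtain \<tau>1 where \<tau>1: "\<tau>1 \<in> set (extensions ?q \<tau> (block_start r j - length \<tau>))" "\<not> big ?q k B \<tau>1"
    using ex_not_big_extension[OF \<tau>(2,3)] by blast
  have len1: "length \<tau>1 = block_start r j" using length_mem_extensions[OF \<tau>1(1)] len_j by simp
  have bnd1: "bounded_string ?q \<tau>1" using bounded_mem_extensions[OF \<tau>(1) \<tau>1(1)] .
  have take1: "take (length \<tau>) \<tau>1 = \<tau>" using take_mem_extensions[OF \<tau>1(1)] .
  define d where "d m = block_start r m - block_start r j" for m
  let ?E = "\<lambda>m. extensions ?q \<tau>1 (d m)"
  let ?good = "\<lambda>\<rho>. \<not> big ?q k B \<rho>"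
  let ?F = "\<lambda>m. (\<lambda>X. init_seg X (r m)) ` P"
  have E: "length \<rho> = block_start r m" "bounded_string ?q \<rho>" "take (length \<tau>) \<rho> = \<tau>" "length \<tau> < length \<rho>"
    if m: "j \<le> m" and \<rho>: "\<rho> \<in> set (?E m)" for m \<rho>
  proof -
    show len: "length \<rho> = block_start r m"
      using length_mem_extensions[OF \<rho>] block_start_mono[OF m, of r] by (simp add: len1 d_def)
    show "bounded_string ?q \<rho>" using bounded_mem_extensions[OF bnd1 \<rho>] .
    show "length \<tau> < length \<rho>" using len len_j block_start_mono[OF m, of r] by simp
    have "take (length \<tau>) \<rho> = take (length \<tau>) (take (length \<tau>1) \<rho>)" using len_j len1 by (simp add: min_def)
    then show "take (length \<tau>) \<rho> = \<tau>" using take_mem_extensions[OF \<rho>] take1 by simp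
  qed
  \<comment> \<open>Forbidding \<open>A m\<close> as well raises the parameter to
    \<open>k + 2 ^ r m * k\<close>, and the bound must be at least that from the new stem on. The
    factor \<open>2 ^ r m\<close> of the bound is spent here.\<close>
  have q_ge: "k + 2 ^ r m * k \<le> ?q n" if "j \<le> m" "block_start r m \<le> n" for m n
  proof -
    have "k + 2 ^ r m * k \<le> 2 ^ r m * k + 2 ^ r m * k" by simp
    also have "\<dots> = (2 * k) * 2 ^ r m" by simp
    also have "\<dots> \<le> (m + 2) * 2 ^ r m" using that(1) by (intro mult_right_mono) (auto simp: j_def)
    also have "\<dots> \<le> ?q n" using block_bound_ge[OF r(2) that(2)] .
    finally show ?thesis .
  qed
  define A where "A m = (\<Union>\<sigma>\<in>{\<sigma>. length \<sigma> = r m}. forced e \<sigma>)" for m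

  \<comment> \<open>If the set were small, forbidding it would leave a condition that keeps
    \<open>e\<close> from ever giving \<open>r m\<close> bits.\<close>
  have diverge: "big ?q (2 ^ r m * k) (A m) \<rho>" if m: "j \<le> m" and \<rho>: "\<rho> \<in> set (?E m)" "?good \<rho>" for m \<rho>
  proof (rule ccontr)
    assume "\<not> big ?q (2 ^ r m * k) (A m) \<rho>"
    then have "\<not> big ?q (k + 2 ^ r m * k) (B \<union> A m) \<rho>" using big_union \<rho>(2) by blast
    moreover have "\<forall>n\<ge>length \<rho>. k + 2 ^ r m * k \<le> ?q n" using q_ge[OF m] E(1)[OF m \<rho>(1)] by simp
    ultimately have "condition ?q (\<rho>, B \<union> A m, k + 2 ^ r m * k)"
      using E(2)[OF m \<rho>(1)] B by (auto simp: condition_def A_def intro: forced_append)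
    moreover have "strengthens (\<rho>, B \<union> A m, k + 2 ^ r m * k) (\<tau>, B, k)"
      using E(3,4)[OF m \<rho>(1)] by (simp add: strengthens_def)
    moreover have "?avoids \<rho> (B \<union> A m)"
    proof (intro allI impI ballI)
      fix Y X assume Y: "\<forall>n. map Y [0..<n] \<notin> B \<union> A m"
      show "\<exists>n. rec_eval (\<lambda>k. Some (Y k)) e [n] \<noteq> Some (baire_of X n)"
      proof (rule ccontr)
        assume "\<nexists>n. rec_eval (\<lambda>k. Some (Y k)) e [n] \<noteq> Some (baire_of X n)"
        then have "\<exists>s. map Y [0..<s] \<in> forced e (init_seg X (r m))"
          by (intro initial_forced) (simp add: init_seg_def baire_of_def)
        then show False using Y by (auto simp: A_def init_seg_def)
      qed
    qed
    ultimately show False using contra by blast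
  qed

  \<comment> \<open>Otherwise a leaf in \<open>forced e \<sigma>\<close> above which
    \<open>B\<close> is still small would commit \<open>e\<close> to an output outside
    \<open>P\<close>, with \<open>B\<close> and \<open>k\<close> unchanged.\<close>
  have wrong: "\<sigma> \<in> ?F m"
    if m: "j \<le> m" and \<rho>: "\<rho> \<in> set (?E m)" "?good \<rho>" and \<sigma>: "length \<sigma> = r m" "big ?q k (forced e \<sigma>) \<rho>" for m \<rho> \<sigma>
  proof (rule ccontr)
    assume \<sigma>F: "\<sigma> \<notin> ?F m"
    obtain \<rho>' where \<rho>': "\<rho>' \<in> forced e \<sigma>" "?good \<rho>'" "bounded_string ?q \<rho>'" "take (length \<rho>) \<rho>' = \<rho>"
      using big_leaf_not_big[OF \<sigma>(2) \<rho>(2) E(2)[OF m \<rho>(1)]] by blast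
    have len: "length \<rho> \<le> length \<rho>'" using \<rho>'(4) by (metis length_take min.cobounded1)
    have "take (length \<tau>) \<rho>' = take (length \<tau>) (take (length \<rho>) \<rho>')"
      using E(4)[OF m \<rho>(1)] by (simp add: min_def)
    then have "take (length \<tau>) \<rho>' = \<tau>" using \<rho>'(4) E(3)[OF m \<rho>(1)] by simp
    then have "strengthens (\<rho>', B, k) (\<tau>, B, k)"
      using E(4)[OF m \<rho>(1)] len by (simp add: strengthens_def)
    moreover have "condition ?q (\<rho>', B, k)"
      using \<rho>'(2,3) B \<tau>(3) len E(4)[OF m \<rho>(1)] by (simp add: condition_def)
    moreover have "?avoids \<rho>' B"
    proof (intro allI impI ballI)
      fix Y X assume Y: "map Y [0..<length \<rho>'] = \<rho>'" and X: "X \<in> P"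
      show "\<exists>n. rec_eval (\<lambda>k. Some (Y k)) e [n] \<noteq> Some (baire_of X n)"
      proof (rule ccontr)
        assume *: "\<nexists>n. rec_eval (\<lambda>k. Some (Y k)) e [n] \<noteq> Some (baire_of X n)"
        have "\<sigma> ! i = X i" if "i < r m" for i
        proof -
          have "rec_eval (\<lambda>k. Some (Y k)) e [i] = Some (of_bool (\<sigma> ! i))"
            by (rule forced_initial[where s = "length \<rho>'"]) (use Y \<rho>'(1) \<sigma>(1) that in simp_all)
          with * have "of_bool (\<sigma> ! i) = (of_bool (X i) :: nat)" by (simp add: baire_of_def)
          then show ?thesis by (simp only: of_bool_eq_iff)
        qed
        then have "\<sigma> = init_seg X (r m)"
          using \<sigma>(1) by (intro nth_equalityI) (simp_all add: init_seg_def)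
        then show False using \<sigma>F X by blast
      qed
    qed
    ultimately show False using contra by blast
  qed

  have some: "\<exists>\<sigma>. length \<sigma> = r m \<and> big ?q k (forced e \<sigma>) \<rho>"
    if m: "j \<le> m" and \<rho>: "\<rho> \<in> set (?E m)" "?good \<rho>" for m \<rho>
  proof -
    let ?I = "{\<sigma> :: bool list. length \<sigma> = r m}"
    have I: "finite ?I" "card ?I = 2 ^ r m"
      using finite_lists_length_eq[of "UNIV :: bool set" "r m"] card_lists_length_eq[of "UNIV :: bool set" "r m"]
      by simp_all
    have "?I \<noteq> {}" using I(2) by (metis card.empty power_not_zero zero_neq_numeral)
    moreover have "big ?q (card ?I * k) (\<Union>\<sigma>\<in>?I. forced e \<sigma>) \<rho>"
      using diverge[OF m \<rho>] by (simp add: A_def I(2))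
    ultimately have "\<exists>\<sigma>\<in>?I. big ?q k (forced e \<sigma>) \<rho>" using big_UN[OF I(1)] by blast
    then show ?thesis by simp
  qed

  have q_pos: "\<forall>n. 0 < ?q n" using block_bound_ge_2[of r] by (metis less_le_trans zero_less_numeral)
  have "computable d"
    unfolding d_def[abs_def] by (intro computable_intros computable_compose[OF computable_block_start[OF r(1)]])
  from bushy_semimeasure[OF r(1) computable_block_bound[OF r(1)] this q_pos, of \<tau>1 k e]
  obtain \<nu> where \<nu>: "continuous_semimeasure \<nu>" "left_re \<nu>"
    and \<nu>_ge: "\<And>m F g. finite F \<Longrightarrow>
      \<forall>\<rho>\<in>set (?E m). g \<rho> \<longrightarrow>
        (\<exists>\<sigma>. length \<sigma> = r m \<and> big ?q k (forced e \<sigma>) \<rho>) \<and>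
        (\<forall>\<sigma>. length \<sigma> = r m \<longrightarrow> big ?q k (forced e \<sigma>) \<rho> \<longrightarrow> \<sigma> \<in> F) \<Longrightarrow>
      (3 / 4) ^ m / 4 * (real (length (filter g (?E m))) / real (length (?E m))) \<le> (\<Sum>\<sigma>\<in>F. \<nu> \<sigma>)"
    by blast
  obtain c :: nat where c: "\<And>\<sigma>. \<nu> \<sigma> \<le> real c * M \<sigma>"
    using univ \<nu> by (auto simp: universal_semimeasure_def)
  \<comment> \<open>Density and mixture weight contribute \<open>(3 / 4) ^ m\<close> each, against
    \<open>1 / 2 ^ m\<close> from depth, and \<open>2 * (3 / 4) ^ 2 = 9 / 8\<close>. Replacing
    \<open>m - j\<close> by \<open>m\<close> only weakens the density.\<close>
  have bound: "(9 / 8) ^ m \<le> 4 * real c" if m: "j \<le> m" for m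
  proof -
    have "finite {\<sigma> :: bool list. length \<sigma> = r m}"
      using finite_lists_length_eq[of "UNIV :: bool set" "r m"] by simp
    then have fin: "finite (?F m)"
      by (rule finite_subset[rotated]) (auto simp: init_seg_def)
    have "(3 / 4) ^ (m - j) * real (length (?E m)) \<le>
        (\<Prod>i<d m. 1 - real k / real (?q (length \<tau>1 + i))) * real (length (?E m))"
      using prod_block_bound_ge[of k j m r] m by (intro mult_right_mono) (simp_all add: j_def d_def len1)
    also have "\<dots> \<le> real (length (filter ?good (?E m)))"
    proof (rule extensions_density[OF \<tau>1(2) _ q_pos])
      show "\<forall>n\<ge>length \<tau>1. k \<le> ?q n" using \<tau>(3) len1 len_j by simp
    qed
    finally have "(3 / 4) ^ (m - j) \<le> real (length (filter ?good (?E m))) / real (length (?E m))"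
      using q_pos by (simp add: pos_le_divide_eq length_extensions prod_pos)
    moreover have "(3 / 4) ^ m \<le> ((3 / 4) ^ (m - j) :: real)"
      by (rule power_decreasing) auto
    ultimately have "(3 / 4) ^ m \<le> real (length (filter ?good (?E m))) / real (length (?E m))"
      by linarith
    then have "(3 / 4) ^ m / 4 * (3 / 4) ^ m \<le>
        (3 / 4) ^ m / 4 * (real (length (filter ?good (?E m))) / real (length (?E m)))"
      by (intro mult_left_mono) auto
    also have "\<dots> \<le> (\<Sum>\<sigma>\<in>?F m. \<nu> \<sigma>)"
      by (rule \<nu>_ge[OF fin]) (use some[OF m] wrong[OF m] in blast)
    also have "\<dots> \<le> (\<Sum>\<sigma>\<in>?F m. real c * M \<sigma>)"
      by (rule sum_mono) (rule c)
    also have "\<dots> = real c * (\<Sum>\<sigma>\<in>?F m. M \<sigma>)" by (rule sum_distrib_left[symmetric])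
    also have "\<dots> \<le> real c * (1 / 2 ^ m)" by (intro mult_left_mono deep) simp
    finally have "(3 / 4) ^ m * (3 / 4) ^ m * 2 ^ m \<le> 4 * real c" by (simp add: field_simps)
    moreover have "(3 / 4) ^ m * (3 / 4) ^ m * 2 ^ m = (9 / 8 :: real) ^ m"
      by (simp flip: power_mult_distrib)
    ultimately show ?thesis by simp
  qed
  obtain n where n: "4 * real c < (9 / 8) ^ n" using real_arch_pow[of "9 / 8" "4 * real c"] by auto
  have "(9 / 8 :: real) ^ n \<le> (9 / 8) ^ max n j" by (rule power_increasing) auto
  with n bound[of "max n j"] show False by simp
qed

text \<open>Programs can be listed, one requirement for each step of the construction.\<close>

instance rec_prog :: countable
  by countable_datatype

text \<open>Successive conditions meet the requirement of the program numbered \<open>n\<close> in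
  passing from \<open>n\<close> to \<open>Suc n\<close>. In the limit, boundedness comes from the
  stems and avoidance of \<psi> from the initial forbidden set.\<close>

lemma LUA_slow_not_below_deep:
  fixes M :: "bool list \<Rightarrow> real" and P :: "(nat \<Rightarrow> bool) set"
  assumes univ: "universal_semimeasure M" and "deep M P" and \<psi>: "linearly_universal \<psi>"
  shows "\<exists>Y\<in>LUA_slow. \<forall>X\<in>P. \<not> turing_computes Y (baire_of X)"
proof -
  obtain r where r: "order_function (\<lambda>n. real (r n))"
    and deep: "\<And>n. (\<Sum>\<sigma>\<in>(\<lambda>X. init_seg X (r n)) ` P. M \<sigma>) \<le> 1 / 2 ^ n"
    using assms(2) by (auto simp: deep_def)
  have comp_r: "computable r" using r by (rule computable_nat_order_function)
  have mono_r: "mono r" using r by (auto simp: order_function_def mono_def)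
  let ?q = "block_bound r"
  define B0 where "B0 = {\<tau>. \<exists>i<length \<tau>. \<psi> i = Some (\<tau> ! i)}"
  define prog where "prog n = (from_nat n :: rec_prog)" for n
  let ?avoids = "\<lambda>e \<tau> B. \<forall>Y. map Y [0..<length \<tau>] = \<tau> \<longrightarrow> (\<forall>n. map Y [0..<n] \<notin> B) \<longrightarrow>
      (\<forall>X\<in>P. \<exists>n. rec_eval (\<lambda>k. Some (Y k)) e [n] \<noteq> Some (baire_of X n))"
  \<comment> \<open>The empty string hits nothing, so the hits are not \<open>2\<close>-big above
    it, and the bound is at least \<open>2\<close> everywhere.\<close>
  have init: "condition ?q ([], B0, 2)"
    using not_big_hits[of "[]" \<psi> ?q] block_bound_ge_2[of r]
    by (auto simp: condition_def B0_def bounded_string_def nth_append)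
  define Q where "Q n x y \<longleftrightarrow> strengthens y x \<and> ?avoids (prog n) (fst y) (fst (snd y))" for n x y
  have "\<exists>S. \<forall>n. (condition ?q (S n) \<and> (n = 0 \<longrightarrow> S n = ([], B0, 2))) \<and> Q n (S n) (S (Suc n))"
  proof (rule dependent_nat_choice)
    show "\<exists>x. condition ?q x \<and> ((0::nat) = 0 \<longrightarrow> x = ([], B0, 2))" using init by blast
    show "\<exists>y. (condition ?q y \<and> (Suc n = 0 \<longrightarrow> y = ([], B0, 2))) \<and> Q n x y"
      if cond_x: "condition ?q x \<and> (n = 0 \<longrightarrow> x = ([], B0, 2))" for x n
    proof -
      obtain \<tau> B k where x: "x = (\<tau>, B, k)" by (cases x)
      obtain \<tau>' B' k' where "condition ?q (\<tau>', B', k')" "strengthens (\<tau>', B', k') (\<tau>, B, k)"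
        "?avoids (prog n) \<tau>' B'"
        using condition_forces_avoidance[OF univ deep comp_r mono_r cond_x[THEN conjunct1, unfolded x], of "prog n"]
        by blast
      then have "condition ?q (\<tau>', B', k') \<and> Q n x (\<tau>', B', k')"
        unfolding Q_def x by simp
      then show ?thesis by blast
    qed
  qed
  then obtain S where S: "\<And>n. condition ?q (S n)" "S 0 = ([], B0, 2)" "\<And>n. Q n (S n) (S (Suc n))"
    by blast
  note cond = S(1) and S0 = S(2)
  have ref: "strengthens (S (Suc n)) (S n)" for n
    using S(3)[of n] unfolding Q_def by blast
  have avoid: "?avoids (prog n) (fst (S (Suc n))) (fst (snd (S (Suc n))))" for n
    using S(3)[of n] unfolding Q_def by blast
  define \<tau> where "\<tau> n = fst (S n)" for n
  define B where "B n = fst (snd (S n))" for n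
  have ref': "take (length (\<tau> n)) (\<tau> (Suc n)) = \<tau> n" "length (\<tau> n) < length (\<tau> (Suc n))" "B n \<subseteq> B (Suc n)" for n
    using ref[of n] by (auto simp: strengthens_def \<tau>_def B_def split: prod.splits)
  have len: "n \<le> length (\<tau> n)" for n
  proof (induction n)
    case (Suc n)
    then show ?case using ref'(2)[of n] by simp
  qed simp
  have B_mono: "B m \<subseteq> B n" if "m \<le> n" for m n
    using that ref'(3) by (rule lift_Suc_mono_le[of B, rotated])
  have \<tau>_take: "take (length (\<tau> m)) (\<tau> n) = \<tau> m \<and> length (\<tau> m) \<le> length (\<tau> n)" if "m \<le> n" for m n
    using that
  proof (induction n rule: dec_induct)
    case (step n)
    have "take (length (\<tau> m)) (\<tau> (Suc n)) = take (length (\<tau> m)) (take (length (\<tau> n)) (\<tau> (Suc n)))"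
      using step.IH by (simp add: min_def)
    then show ?case using step.IH ref'(1,2)[of n] by simp
  qed simp
  \<comment> \<open>The stem at \<open>Suc i\<close> has length at least \<open>Suc i\<close>, so
    this entry exists.\<close>
  define Y where "Y i = \<tau> (Suc i) ! i" for i
  have Y: "\<tau> n ! i = Y i" if "i < length (\<tau> n)" for n i
  proof -
    have "\<tau> m ! i = \<tau> (max m n') ! i" if "i < length (\<tau> m)" for m n'
      using \<tau>_take[of m "max m n'"] that by (metis max.cobounded1 nth_take)
    from this[of n "Suc i"] this[of "Suc i" n] show ?thesis
      using that len[of "Suc i"] by (simp add: Y_def max.commute)
  qed
  have Y_map: "map Y [0..<s] = take s (\<tau> n)" if "s \<le> length (\<tau> n)" for s n
    using that by (intro nth_equalityI) (simp_all add: Y)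
  have cond': "bounded_string ?q (\<tau> n)" "\<tau> n \<notin> B n" "\<And>\<rho> \<rho>'. \<rho> \<in> B n \<Longrightarrow> \<rho> @ \<rho>' \<in> B n" for n
    using cond[of n] by (auto simp: condition_def \<tau>_def B_def split: prod.splits intro: big.leaf)
  \<comment> \<open>By closure under extension a forbidden initial segment would put a later stem
    into its own forbidden set, which would be big there by \<open>big.leaf\<close>.\<close>
  have Y_B: "map Y [0..<s] \<notin> B n" for s n
  proof
    assume "map Y [0..<s] \<in> B n"
    then have "map Y [0..<s] \<in> B (max n s)" using B_mono[of n "max n s"] by auto
    moreover have "map Y [0..<s] = take s (\<tau> (max n s))"
      using len[of "max n s"] by (intro Y_map) simp
    ultimately have "take s (\<tau> (max n s)) @ drop s (\<tau> (max n s)) \<in> B (max n s)"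
      by (intro cond'(3)) simp
    then show False using cond'(2)[of "max n s"] by simp
  qed
  have "real (Y n) < real (?q n)" for n
    using cond'(1)[of "Suc n"] len[of "Suc n"] by (simp add: bounded_string_def Y_def)
  moreover have "\<not> (\<exists>n\<in>dom \<psi>. \<psi> n = Some (Y n))"
  proof
    assume "\<exists>n\<in>dom \<psi>. \<psi> n = Some (Y n)"
    then obtain n where "\<psi> n = Some (Y n)" by blast
    then have "map Y [0..<Suc n] \<in> B0" by (auto simp: B0_def intro!: exI[of _ n] simp del: upt_Suc)
    then show False using Y_B[of "Suc n" 0] by (simp add: B_def S0)
  qed
  ultimately have "Y \<in> LUA (\<lambda>n. real (?q n))" using \<psi> by (auto simp: LUA_def)
  then have "Y \<in> LUA_slow"
    unfolding LUA_slow_def using slow_growing_block_bound[OF comp_r mono_r] by blast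
  moreover have "\<not> turing_computes Y (baire_of X)" if "X \<in> P" for X
  proof
    assume "turing_computes Y (baire_of X)"
    then obtain e where e: "\<And>n. rec_eval (\<lambda>k. Some (Y k)) e [n] = Some (baire_of X n)"
      by (auto simp: turing_computes_def)
    let ?n = "to_nat e"
    have "map Y [0..<length (\<tau> (Suc ?n))] = \<tau> (Suc ?n)" using Y_map[OF order_refl] by simp
    then show False
      using avoid[of ?n, rule_format, of Y X] Y_B[of _ "Suc ?n"] \<open>X \<in> P\<close> e
      by (simp add: prog_def \<tau>_def B_def)
  qed
  ultimately show ?thesis by blast
qed

theorem mainTheorem7:
  fixes M :: "bool list \<Rightarrow> real"
  assumes "universal_semimeasure M"
  shows "\<not> (\<exists>P :: (nat \<Rightarrow> bool) set. Pi01_class P \<and> P \<noteq> {} \<and> deep M P \<and>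
               baire_of ` P \<equiv>\<^sub>w LUA_slow)"
proof
  assume "\<exists>P :: (nat \<Rightarrow> bool) set. Pi01_class P \<and> P \<noteq> {} \<and> deep M P \<and> baire_of ` P \<equiv>\<^sub>w LUA_slow"
  then obtain P where P: "P \<noteq> {}" "deep M P" and below: "baire_of ` P \<le>\<^sub>w LUA_slow" and above: "LUA_slow \<le>\<^sub>w baire_of ` P"
    by (auto simp: weakly_equivalent_def)
  have "LUA_slow \<noteq> {}" using P(1) above by (auto simp: weakly_reducible_def)
  then obtain \<psi> where "linearly_universal \<psi>" by (auto simp: LUA_slow_def LUA_def)
  from LUA_slow_not_below_deep[OF assms P(2) this] below show False
    by (auto simp: weakly_reducible_def)
qed


end
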